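(* Let $n\ge 1$; all transfer function matrices below are $n\times n$. (I) Let $\gamma>0$ and let $M(s)\in\mathscr{C}_s$ with $M(\infty)\ge 0$. Then: (a) $[\Delta(s),M(s)]$ is internally stable for all $\Delta(s)\in\mathscr{C}$ satisfying $\Delta(\infty)M(\infty)=0$ and $\overline{\lambda}(\Delta(0))<\gamma$ if and only if $\overline{\lambda}(M(0))\le\frac{1}{\gamma}$; (b) $[\Delta(s),M(s)]$ is internally stable for all $\Delta(s)\in\mathscr{C}$ satisfying $\Delta(\infty)M(\infty)=0$ and $\overline{\lambda}(\Delta(0))\le\gamma$ if and only if $\overline{\lambda}(M(0))<\frac{1}{\gamma}$. (II) Let $\gamma>0$ and let $M(s)\in\mathscr{C}$. Then: (a) $[\Delta(s),M(s)]$ is internally stable for all $\Delta(s)\in\mathscr{C}_s$ satisfying $\Delta(\infty)\ge 0$, $\Delta(\infty)M(\infty)=0$ and $\overline{\lambda}(\Delta(0))<\gamma$ if and only if $\overline{\lambda}(M(0))\le\frac{1}{\gamma}$; (b) $[\Delta(s),M(s)]$ is internally stable for all $\Delta(s)\in\mathscr{C}_s$ satisfying $\Delta(\infty)\ge 0$, $\Delta(\infty)M(\infty)=0$ and $\overline{\lambda}(\Delta(0))\le\gamma$ if and only if $\overline{\lambda}(M(0))<\frac{1}{\gamma}$.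
   Context: $\mathscr{RH}_\infty^{n\times n}$ denotes the set of $n\times n$ real-rational, proper, stable transfer function matrices (all poles in the open left half plane). $X^*$ denotes the complex conjugate transpose of $X$. For matrices, $X>0$ (resp. $X\ge 0$) means $X$ is Hermitian (symmetric in the real case) and positive definite (resp. positive semidefinite). $R(\infty)$ denotes $\lim_{s\to\infty}R(s)$. With $j$ the imaginary unit, define $$\mathscr{C}:=\{R(s)\in\mathscr{RH}_\infty^{n\times n}:\ j[R(j\omega)-R(j\omega)^*]\ge 0\ \text{ for all }\omega\in(0,\infty)\},$$ $$\mathscr{C}_s:=\{R(s)\in\mathscr{RH}_\infty^{n\times n}:\ j[R(j\omega)-R(j\omega)^*]> 0\ \text{ for all }\omega\in(0,\infty)\}.$$ $\overline{\lambda}(A)$ denotes the maximum eigenvalue of a square complex matrix $A$ that has only real eigenvalues (for $R(s)\in\mathscr{C}$, $R(0)$ is real symmetric). $[\Delta(s),M(s)]$ denotes the positive feedback interconnection of $\Delta(s)$ and $M(s)$: with external inputs $w_1,w_2$, the input of $\Delta$ is $e_1=w_1+Me_2$ and the input of $M$ is $e_2=w_2+\Delta e_1$. Internal stability has its standard meaning: the loop is well-posed ($I-\Delta(\infty)M(\infty)$ is invertible) and all the transfer function matrices from $(w_1,w_2)$ to $(e_1,e_2)$ are in $\mathscr{RH}_\infty$. *)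

theory Defs
  imports
    "HOL-Analysis.Analysis"
    "HOL-Computational_Algebra.Computational_Algebra"
    "HOL-Computational_Algebra.Field_as_Ring"
begin

text \<open>
  A real-rational function of the Laplace variable is an element of the field of fractions of
  \<^typ>\<open>real poly\<close>. Numerator and denominator are those of the reduced fraction, so the zeros of
  the denominator are exactly the poles.
\<close>

type_synonym ratfun = "real poly fract"

definition num_poly :: "ratfun \<Rightarrow> complex poly" where
  "num_poly r = map_poly complex_of_real (fst (quot_of_fract r))"

definition den_poly :: "ratfun \<Rightarrow> complex poly" where
  "den_poly r = map_poly complex_of_real (snd (quot_of_fract r))"

definition poles :: "ratfun \<Rightarrow> complex set" where
  "poles r = {s. poly (den_poly r) s = 0}"

definition proper :: "ratfun \<Rightarrow> bool" where
  "proper r \<longleftrightarrow> degree (num_poly r) \<le> degree (den_poly r)"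

definition RH_inf :: "(ratfun ^ 'n ^ 'n) set" where
  "RH_inf = {R. \<forall>i j. proper (R $ i $ j) \<and> (\<forall>s \<in> poles (R $ i $ j). Re s < 0)}"

text \<open>Evaluation is meaningful only away from the poles (division by zero gives 0 there).\<close>

definition tf_eval :: "ratfun ^ 'n ^ 'n \<Rightarrow> complex \<Rightarrow> complex ^ 'n ^ 'n" where
  "tf_eval R s = (\<chi> i j. poly (num_poly (R $ i $ j)) s / poly (den_poly (R $ i $ j)) s)"

definition tf_at_infinity :: "ratfun ^ 'n ^ 'n \<Rightarrow> complex ^ 'n ^ 'n" where
  "tf_at_infinity R = Lim at_infinity (tf_eval R)"

definition conj_transpose :: "complex ^ 'n ^ 'm \<Rightarrow> complex ^ 'm ^ 'n" where
  "conj_transpose A = (\<chi> i j. cnj (A $ j $ i))"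

definition quad_form :: "complex ^ 'n ^ 'n \<Rightarrow> complex ^ 'n \<Rightarrow> complex" where
  "quad_form A x = (\<Sum>i\<in>UNIV. cnj (x $ i) * (A *v x) $ i)"

text \<open>
  The quadratic form of a Hermitian matrix is real-valued, hence the real parts below.
\<close>

definition pos_semidef :: "complex ^ 'n ^ 'n \<Rightarrow> bool" where
  "pos_semidef A \<longleftrightarrow> conj_transpose A = A \<and> (\<forall>x. 0 \<le> Re (quad_form A x))"

definition pos_def :: "complex ^ 'n ^ 'n \<Rightarrow> bool" where
  "pos_def A \<longleftrightarrow> conj_transpose A = A \<and> (\<forall>x. x \<noteq> 0 \<longrightarrow> 0 < Re (quad_form A x))"

definition eigenvalues :: "complex ^ 'n ^ 'n \<Rightarrow> complex set" where
  "eigenvalues A = {z. \<exists>v. v \<noteq> 0 \<and> A *v v = z *s v}"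

text \<open>Intended only for matrices all of whose eigenvalues are real.\<close>

definition max_eigenvalue :: "complex ^ 'n ^ 'n \<Rightarrow> real" where
  "max_eigenvalue A = Max (Re ` eigenvalues A)"

definition imag_axis_form :: "ratfun ^ 'n ^ 'n \<Rightarrow> real \<Rightarrow> complex ^ 'n ^ 'n" where
  "imag_axis_form R \<omega> =
     (let A = tf_eval R (\<i> * complex_of_real \<omega>) in (\<chi> a b. \<i> * (A - conj_transpose A) $ a $ b))"

definition class_C :: "(ratfun ^ 'n ^ 'n) set" where
  "class_C = {R \<in> RH_inf. \<forall>\<omega>>0. pos_semidef (imag_axis_form R \<omega>)}"

definition class_Cs :: "(ratfun ^ 'n ^ 'n) set" where
  "class_Cs = {R \<in> RH_inf. \<forall>\<omega>>0. pos_def (imag_axis_form R \<omega>)}"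

text \<open>
  Positive feedback loop \<open>e1 = w1 + M e2\<close>, \<open>e2 = w2 + \<Delta> e1\<close>, with signals being vectors over the
  field of rational functions. The matrices \<open>Gij\<close> are the transfer function matrices from \<open>wj\<close>
  to \<open>ei\<close> iff the loop equations have exactly the solutions given by the \<open>Gij\<close>.
\<close>

definition loop_transfer ::
  "ratfun ^ 'n ^ 'n \<Rightarrow> ratfun ^ 'n ^ 'n \<Rightarrow> ratfun ^ 'n ^ 'n \<Rightarrow> ratfun ^ 'n ^ 'n \<Rightarrow>
   ratfun ^ 'n ^ 'n \<Rightarrow> ratfun ^ 'n ^ 'n \<Rightarrow> bool" where
  "loop_transfer \<Delta> M G11 G12 G21 G22 \<longleftrightarrow>
     (\<forall>w1 w2 e1 e2.
        (e1 = w1 + M *v e2 \<and> e2 = w2 + \<Delta> *v e1) \<longleftrightarrow>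
        (e1 = G11 *v w1 + G12 *v w2 \<and> e2 = G21 *v w1 + G22 *v w2))"

definition well_posed :: "ratfun ^ 'n ^ 'n \<Rightarrow> ratfun ^ 'n ^ 'n \<Rightarrow> bool" where
  "well_posed \<Delta> M \<longleftrightarrow> invertible (mat 1 - tf_at_infinity \<Delta> ** tf_at_infinity M)"

definition internally_stable :: "ratfun ^ 'n ^ 'n \<Rightarrow> ratfun ^ 'n ^ 'n \<Rightarrow> bool" where
  "internally_stable \<Delta> M \<longleftrightarrow>
     well_posed \<Delta> M \<and>
     (\<exists>G11 \<in> RH_inf. \<exists>G12 \<in> RH_inf. \<exists>G21 \<in> RH_inf. \<exists>G22 \<in> RH_inf.
        loop_transfer \<Delta> M G11 G12 G21 G22)"

end

theory Submission
  imports Defs "HOL-Complex_Analysis.Conformal_Mappings"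
begin

text \<open>
  The theorem rests on the fact that, for \<open>\<Delta>\<close> in \<^const>\<open>class_C\<close> and \<open>M\<close> in \<^const>\<open>class_Cs\<close> with
  \<open>M(\<infinity>) \<ge> 0\<close> and \<open>\<Delta>(\<infinity>) M(\<infinity>) = 0\<close>, the loop is internally stable as soon as the product of
  the maximum eigenvalues of \<open>\<Delta>(0)\<close> and \<open>M(0)\<close> is less than \<open>1\<close> (lemma \<open>internally_stable_small_gain\<close>).

  Internal stability means that \<open>det (I - \<Delta> M)\<close> vanishes neither in the closed right half plane nor
  at infinity (lemmas \<open>internally_stableI\<close> and \<open>internally_stable_imp_nonsingular\<close>). To exclude zeros,
  consider \<open>I - t \<Delta> M\<close> for \<open>t\<close> from \<open>0\<close> to \<open>1\<close>. On the imaginary axis without \<open>0\<close> it is nonsingular by the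
  strict negative imaginary property; at infinity because \<open>\<Delta>(\<infinity>) M(\<infinity>)\<close> is nilpotent; at \<open>0\<close> by the gain
  condition, where \<open>M(0) > M(\<infinity>) \<ge> 0\<close> is needed (lemmas \<open>loop_nonsingular_boundary\<close>,
  \<open>loop_nonsingular_infinity\<close> and \<open>class_Cs_dc_pos\<close>). Thus no zero crosses the boundary during the homotopy, and as
  there is none for \<open>t = 0\<close>, there is none for \<open>t = 1\<close>. This is carried out on the unit disc, after a
  Moebius transformation, with the maximum principle (lemma \<open>zero_free_homotopy\<close>).

  Conversely, if the maximum eigenvalue \<open>\<mu>\<close> of \<open>M(0)\<close> is positive, \<open>\<Delta>(s) = 1 / (\<mu> (s + 1)) I\<close> is a strictly
  negative imaginary system with \<open>\<Delta>(\<infinity>) = 0\<close> and \<open>\<Delta>(0) = I / \<mu>\<close> for which \<open>I - \<Delta>(0) M(0)\<close> is singular, so the gain bounds cannot be relaxed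
  (lemma \<open>destabilizing_lag\<close>). The second part follows from the first argument by exchanging the two systems,
  since internal stability of the loop does not depend on their order.
\<close>

unbundle no Formal_Power_Series.fps_syntax

section \<open>Stable proper rational functions\<close>

text \<open>Numerators and denominators have real coefficients but are evaluated at complex points.\<close>

abbreviation cpoly :: "real poly \<Rightarrow> complex poly" where
  "cpoly \<equiv> map_poly complex_of_real"

lemma coeff_cpoly: "coeff (cpoly p) n = complex_of_real (coeff p n)"
  by (simp add: coeff_map_poly)

lemma cpoly_add: "cpoly (p + q) = cpoly p + cpoly q"
  by (rule poly_eqI) (simp add: coeff_cpoly)

lemma cpoly_mult: "cpoly (p * q) = cpoly p * cpoly q"
  by (rule poly_eqI) (simp add: coeff_cpoly coeff_mult)

lemma degree_cpoly: "degree (cpoly p) = degree p"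
  by (rule degree_map_poly) simp

lemma cpoly_eq_0_iff: "cpoly p = 0 \<longleftrightarrow> p = 0"
  by (auto simp: poly_eq_iff coeff_cpoly)

lemma poly_cpoly_cnj: "poly (cpoly p) (cnj s) = cnj (poly (cpoly p) s)"
  by (induction p) (simp_all add: map_poly_pCons)

text \<open>
  The proper rational functions without poles in the closed right half plane: the \<open>1 \<times> 1\<close> case of
  \<^const>\<open>RH_inf\<close>. They form a ring, on which evaluation at a point of the closed right half plane is a
  ring homomorphism.
\<close>

definition stable_ratfun :: "ratfun set" where
  "stable_ratfun = {r. proper r \<and> (\<forall>s\<in>poles r. Re s < 0)}"

text \<open>
  The value at a point that is not a pole; at poles the default value is \<open>0\<close>.
\<close>

definition ratfun_eval :: "ratfun \<Rightarrow> complex \<Rightarrow> complex" where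
  "ratfun_eval r s = poly (num_poly r) s / poly (den_poly r) s"

text \<open>
  Properness, and the value where the denominator does not vanish, can be read off any representation of
  a fraction, not only the reduced one, because the two differ by a common factor \<open>d\<close>.
\<close>

lemma Fract_reduced:
  fixes a b :: "real poly"
  assumes "b \<noteq> 0"
  obtains d where "d \<noteq> 0" "a = fst (quot_of_fract (Fract a b)) * d"
    "b = snd (quot_of_fract (Fract a b)) * d"
proof -
  have "quot_of_fract (Fract a b) = normalize_quot (a, b)"
    using assms quot_of_fract_quot_to_fract[of "(a, b)"] by (simp add: quot_to_fract_def)
  then show thesis
    using normalize_quotE[OF assms, of a] that by metis
qed

lemma proper_Fract:
  fixes a b :: "real poly"
  assumes "b \<noteq> 0"
  shows "proper (Fract a b) \<longleftrightarrow> degree a \<le> degree b"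
proof -
  obtain d where d: "d \<noteq> 0" "a = fst (quot_of_fract (Fract a b)) * d"
      "b = snd (quot_of_fract (Fract a b)) * d"
    using Fract_reduced[OF assms] .
  let ?p = "fst (quot_of_fract (Fract a b))" and ?q = "snd (quot_of_fract (Fract a b))"
  have q: "degree b = degree ?q + degree d"
    using d by (metis degree_mult_eq snd_quot_of_fract_nonzero)
  have p: "degree a = (if ?p = 0 then 0 else degree ?p + degree d)"
    using d by (metis degree_mult_eq mult_zero_left degree_0)
  show ?thesis
    using p q unfolding proper_def num_poly_def den_poly_def degree_cpoly
    by (cases "?p = 0") auto
qed

lemma ratfun_eval_Fract:
  fixes a b :: "real poly"
  assumes "poly (cpoly b) s \<noteq> 0"
  shows "s \<notin> poles (Fract a b)" "ratfun_eval (Fract a b) s = poly (cpoly a) s / poly (cpoly b) s"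
proof -
  have "b \<noteq> 0" using assms by auto
  then obtain d where d: "d \<noteq> 0" "a = fst (quot_of_fract (Fract a b)) * d"
      "b = snd (quot_of_fract (Fract a b)) * d"
    using Fract_reduced by blast
  let ?p = "fst (quot_of_fract (Fract a b))" and ?q = "snd (quot_of_fract (Fract a b))"
  have b: "poly (cpoly b) s = poly (cpoly ?q) s * poly (cpoly d) s"
    using d(3) cpoly_mult poly_mult by metis
  have a: "poly (cpoly a) s = poly (cpoly ?p) s * poly (cpoly d) s"
    using d(2) cpoly_mult poly_mult by metis
  show "s \<notin> poles (Fract a b)"
    using assms b by (auto simp: poles_def den_poly_def)
  show "ratfun_eval (Fract a b) s = poly (cpoly a) s / poly (cpoly b) s"
    using assms b a by (simp add: ratfun_eval_def num_poly_def den_poly_def)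
qed

lemma stable_ratfun_FractI:
  assumes "b \<noteq> 0" "degree a \<le> degree b" "\<And>s. 0 \<le> Re s \<Longrightarrow> poly (cpoly b) s \<noteq> 0"
  shows "Fract a b \<in> stable_ratfun"
  using assms ratfun_eval_Fract(1) unfolding stable_ratfun_def
  by (auto simp: proper_Fract) (meson linorder_not_less)

lemma stable_ratfunE:
  assumes "r \<in> stable_ratfun"
  obtains a b where "r = Fract a b" "b \<noteq> 0" "degree a \<le> degree b"
    "\<forall>s. 0 \<le> Re s \<longrightarrow> poly (cpoly b) s \<noteq> 0"
    "\<forall>s. ratfun_eval r s = poly (cpoly a) s / poly (cpoly b) s"
proof (rule that[of "fst (quot_of_fract r)" "snd (quot_of_fract r)"])
  show "\<forall>s. 0 \<le> Re s \<longrightarrow> poly (cpoly (snd (quot_of_fract r))) s \<noteq> 0"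
    using assms by (auto simp: stable_ratfun_def poles_def den_poly_def)
qed (use assms in \<open>auto simp: stable_ratfun_def proper_def num_poly_def den_poly_def degree_cpoly
    ratfun_eval_def\<close>)

lemma stable_ratfun_const: "Fract [:c:] 1 \<in> stable_ratfun"
  and ratfun_eval_const: "ratfun_eval (Fract [:c:] 1) s = complex_of_real c"
proof -
  show "Fract [:c:] 1 \<in> stable_ratfun"
    by (rule stable_ratfun_FractI) (simp_all)
  show "ratfun_eval (Fract [:c:] 1) s = complex_of_real c"
    by (subst ratfun_eval_Fract) (simp_all add: map_poly_pCons)
qed

lemma stable_ratfun_0: "0 \<in> stable_ratfun" and stable_ratfun_1: "1 \<in> stable_ratfun"
  and ratfun_eval_0: "ratfun_eval 0 s = 0" and ratfun_eval_1: "ratfun_eval 1 s = 1"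
  using stable_ratfun_const[of 0] stable_ratfun_const[of 1]
    ratfun_eval_const[of 0 s] ratfun_eval_const[of 1 s]
  by (simp_all add: Zero_fract_def One_fract_def pCons_one)

lemma stable_ratfun_add:
  assumes "r \<in> stable_ratfun" "t \<in> stable_ratfun"
  shows "r + t \<in> stable_ratfun"
    and "0 \<le> Re s \<Longrightarrow> ratfun_eval (r + t) s = ratfun_eval r s + ratfun_eval t s"
proof -
  obtain a b where r: "r = Fract a b" "b \<noteq> 0" "degree a \<le> degree b"
    "\<forall>s. 0 \<le> Re s \<longrightarrow> poly (cpoly b) s \<noteq> 0"
    "\<forall>s. ratfun_eval r s = poly (cpoly a) s / poly (cpoly b) s"
    using stable_ratfunE[OF assms(1)] .
  obtain c d where t: "t = Fract c d" "d \<noteq> 0" "degree c \<le> degree d"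
    "\<forall>s. 0 \<le> Re s \<longrightarrow> poly (cpoly d) s \<noteq> 0"
    "\<forall>s. ratfun_eval t s = poly (cpoly c) s / poly (cpoly d) s"
    using stable_ratfunE[OF assms(2)] .
  have eq: "r + t = Fract (a * d + c * b) (b * d)"
    using r t by simp
  have deg: "degree (a * d + c * b) \<le> degree (b * d)"
    using r(2,3) t(2,3) degree_mult_le[of a d] degree_mult_le[of c b]
    by (intro degree_add_le) (auto simp: degree_mult_eq)
  show "r + t \<in> stable_ratfun"
    unfolding eq
  proof (rule stable_ratfun_FractI[OF _ deg])
    show "b * d \<noteq> 0" using r(2) t(2) by simp
    show "poly (cpoly (b * d)) s \<noteq> 0" if "0 \<le> Re s" for s
      using r(4) t(4) that by (simp add: cpoly_mult)
  qed
  show "ratfun_eval (r + t) s = ratfun_eval r s + ratfun_eval t s" if "0 \<le> Re s"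
  proof -
    have nz: "poly (cpoly b) s \<noteq> 0" "poly (cpoly d) s \<noteq> 0"
      using r(4) t(4) that by auto
    then show ?thesis
      unfolding eq r(5)[rule_format] t(5)[rule_format]
      by (subst ratfun_eval_Fract(2)) (simp_all add: cpoly_mult cpoly_add add_frac_eq)
  qed
qed

lemma stable_ratfun_mult:
  assumes "r \<in> stable_ratfun" "t \<in> stable_ratfun"
  shows "r * t \<in> stable_ratfun"
    and "0 \<le> Re s \<Longrightarrow> ratfun_eval (r * t) s = ratfun_eval r s * ratfun_eval t s"
proof -
  obtain a b where r: "r = Fract a b" "b \<noteq> 0" "degree a \<le> degree b"
    "\<forall>s. 0 \<le> Re s \<longrightarrow> poly (cpoly b) s \<noteq> 0"
    "\<forall>s. ratfun_eval r s = poly (cpoly a) s / poly (cpoly b) s"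
    using stable_ratfunE[OF assms(1)] .
  obtain c d where t: "t = Fract c d" "d \<noteq> 0" "degree c \<le> degree d"
    "\<forall>s. 0 \<le> Re s \<longrightarrow> poly (cpoly d) s \<noteq> 0"
    "\<forall>s. ratfun_eval t s = poly (cpoly c) s / poly (cpoly d) s"
    using stable_ratfunE[OF assms(2)] .
  have eq: "r * t = Fract (a * c) (b * d)"
    using r t by simp
  have deg: "degree (a * c) \<le> degree (b * d)"
    using r(2,3) t(2,3) degree_mult_le[of a c] by (auto simp: degree_mult_eq)
  show "r * t \<in> stable_ratfun"
    unfolding eq
  proof (rule stable_ratfun_FractI[OF _ deg])
    show "b * d \<noteq> 0" using r(2) t(2) by simp
    show "poly (cpoly (b * d)) s \<noteq> 0" if "0 \<le> Re s" for s
      using r(4) t(4) that by (simp add: cpoly_mult)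
  qed
  show "ratfun_eval (r * t) s = ratfun_eval r s * ratfun_eval t s" if "0 \<le> Re s"
  proof -
    have nz: "poly (cpoly b) s \<noteq> 0" "poly (cpoly d) s \<noteq> 0"
      using r(4) t(4) that by auto
    then show ?thesis
      unfolding eq r(5)[rule_format] t(5)[rule_format]
      by (subst ratfun_eval_Fract(2)) (simp_all add: cpoly_mult)
  qed
qed

lemma stable_ratfun_uminus:
  assumes "r \<in> stable_ratfun"
  shows "- r \<in> stable_ratfun"
    and "0 \<le> Re s \<Longrightarrow> ratfun_eval (- r) s = - ratfun_eval r s"
proof -
  have eq: "- r = Fract [:- 1:] 1 * r"
    by (cases r) (simp)
  show "- r \<in> stable_ratfun"
    unfolding eq by (intro stable_ratfun_mult stable_ratfun_const assms)
  show "0 \<le> Re s \<Longrightarrow> ratfun_eval (- r) s = - ratfun_eval r s"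
    unfolding eq using assms stable_ratfun_const[of "-1"]
    by (simp add: stable_ratfun_mult ratfun_eval_const)
qed

lemma stable_ratfun_sum:
  assumes "\<And>i. i \<in> I \<Longrightarrow> f i \<in> stable_ratfun"
  shows "(\<Sum>i\<in>I. f i) \<in> stable_ratfun"
    and "0 \<le> Re s \<Longrightarrow> ratfun_eval (\<Sum>i\<in>I. f i) s = (\<Sum>i\<in>I. ratfun_eval (f i) s)"
proof -
  have "(\<Sum>i\<in>I. f i) \<in> stable_ratfun \<and>
      (0 \<le> Re s \<longrightarrow> ratfun_eval (\<Sum>i\<in>I. f i) s = (\<Sum>i\<in>I. ratfun_eval (f i) s))"
    using assms
    by (induction I rule: infinite_finite_induct)
      (auto simp: stable_ratfun_0 ratfun_eval_0 stable_ratfun_add)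
  then show "(\<Sum>i\<in>I. f i) \<in> stable_ratfun"
    and "0 \<le> Re s \<Longrightarrow> ratfun_eval (\<Sum>i\<in>I. f i) s = (\<Sum>i\<in>I. ratfun_eval (f i) s)" by auto
qed

lemma stable_ratfun_prod:
  assumes "\<And>i. i \<in> I \<Longrightarrow> f i \<in> stable_ratfun"
  shows "(\<Prod>i\<in>I. f i) \<in> stable_ratfun"
    and "0 \<le> Re s \<Longrightarrow> ratfun_eval (\<Prod>i\<in>I. f i) s = (\<Prod>i\<in>I. ratfun_eval (f i) s)"
proof -
  have "(\<Prod>i\<in>I. f i) \<in> stable_ratfun \<and>
      (0 \<le> Re s \<longrightarrow> ratfun_eval (\<Prod>i\<in>I. f i) s = (\<Prod>i\<in>I. ratfun_eval (f i) s))"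
    using assms
    by (induction I rule: infinite_finite_induct)
      (auto simp: stable_ratfun_1 ratfun_eval_1 stable_ratfun_mult)
  then show "(\<Prod>i\<in>I. f i) \<in> stable_ratfun"
    and "0 \<le> Re s \<Longrightarrow> ratfun_eval (\<Prod>i\<in>I. f i) s = (\<Prod>i\<in>I. ratfun_eval (f i) s)" by auto
qed

lemma poly_quotient_tendsto:
  fixes p q :: "complex poly"
  assumes "degree p \<le> degree q" "q \<noteq> 0"
  shows "((\<lambda>s. poly p s / poly q s) \<longlongrightarrow> coeff p (degree q) / lead_coeff q) at_infinity"
proof (cases "degree p = degree q")
  case True
  have "((\<lambda>s. (poly p s / s ^ degree p) / (poly q s / s ^ degree q)) \<longlongrightarrow>
      lead_coeff p / coeff q (degree p)) at_infinity"
    using assms True poly_divide_tendsto_aux[of q]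
    by (intro tendsto_divide poly_divide_tendsto_aux) auto
  moreover have "\<forall>\<^sub>F s in at_infinity. (poly p s / s ^ degree p) / (poly q s / s ^ degree q)
      = poly p s / poly q s"
    by (rule eventually_at_infinityI[of 1]) (use True in \<open>auto simp: divide_simps\<close>)
  ultimately show ?thesis
    unfolding True[symmetric] by (rule Lim_transform_eventually)
next
  case False
  then have "degree p < degree q" using assms by simp
  then show ?thesis
    using poly_divide_tendsto_0_at_infinity[of p q] by (simp add: coeff_eq_0)
qed

lemma stable_ratfun_tendsto:
  assumes "r \<in> stable_ratfun"
  shows "\<exists>l. (ratfun_eval r \<longlongrightarrow> l) at_infinity"
proof -
  obtain a b where r: "r = Fract a b" "b \<noteq> 0" "degree a \<le> degree b"
    "\<forall>s. 0 \<le> Re s \<longrightarrow> poly (cpoly b) s \<noteq> 0"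
    "\<forall>s. ratfun_eval r s = poly (cpoly a) s / poly (cpoly b) s"
    using stable_ratfunE[OF assms(1)] .
  have "ratfun_eval r = (\<lambda>s. poly (cpoly a) s / poly (cpoly b) s)"
    using r(5) by auto
  then show ?thesis
    using poly_quotient_tendsto[of "cpoly a" "cpoly b"] r by (auto simp: degree_cpoly cpoly_eq_0_iff)
qed

text \<open>
  The units of the ring are the functions that vanish neither in the closed right half plane nor at
  infinity: the limit \<open>l \<noteq> 0\<close> excludes a drop in degree, which would make the inverse improper.
\<close>

lemma stable_ratfun_inverse:
  assumes "r \<in> stable_ratfun" "(ratfun_eval r \<longlongrightarrow> l) at_infinity" "l \<noteq> 0"
    and nz: "\<And>s. 0 \<le> Re s \<Longrightarrow> ratfun_eval r s \<noteq> 0"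
  shows "inverse r \<in> stable_ratfun"
proof -
  obtain a b where r: "r = Fract a b" "b \<noteq> 0" "degree a \<le> degree b"
    "\<forall>s. 0 \<le> Re s \<longrightarrow> poly (cpoly b) s \<noteq> 0"
    "\<forall>s. ratfun_eval r s = poly (cpoly a) s / poly (cpoly b) s"
    using stable_ratfunE[OF assms(1)] .
  have ev: "ratfun_eval r = (\<lambda>s. poly (cpoly a) s / poly (cpoly b) s)"
    using r(5) by auto
  have a: "poly (cpoly a) s \<noteq> 0" if "0 \<le> Re s" for s
    using nz[OF that] r(5) by auto
  then have a0: "a \<noteq> 0" by (metis cpoly_eq_0_iff poly_0 order.refl zero_complex.simps(1))
  have "degree b \<le> degree a"
  proof (rule ccontr)
    assume "\<not> degree b \<le> degree a"
    then have "degree (cpoly a) < degree (cpoly b)" by (simp add: degree_cpoly)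
    then have "(ratfun_eval r \<longlongrightarrow> 0) at_infinity"
      unfolding ev by (rule poly_divide_tendsto_0_at_infinity)
    then have "l = 0"
      using assms(2) tendsto_unique trivial_limit_at_infinity by blast
    then show False using assms(3) by simp
  qed
  then have "Fract b a \<in> stable_ratfun"
    using a a0 by (intro stable_ratfun_FractI)
  then show ?thesis using r by simp
qed

lemma ratfun_eval_cnj: "ratfun_eval r (cnj s) = cnj (ratfun_eval r s)"
  by (simp add: ratfun_eval_def num_poly_def den_poly_def poly_cpoly_cnj)

lemma ratfun_eval_of_real: "Im (ratfun_eval r (complex_of_real x)) = 0"
proof -
  have "cnj (ratfun_eval r (complex_of_real x)) = ratfun_eval r (complex_of_real x)"
    using ratfun_eval_cnj[of r "complex_of_real x"] by simp
  then show ?thesis by (metis Reals_cnj_iff complex_is_Real_iff)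
qed

lemma stable_ratfun_holomorphic:
  assumes "r \<in> stable_ratfun"
  shows "ratfun_eval r holomorphic_on {s. Re s > 0}" "continuous_on {s. Re s \<ge> 0} (ratfun_eval r)"
proof -
  obtain a b where r: "r = Fract a b" "b \<noteq> 0" "degree a \<le> degree b"
    "\<forall>s. 0 \<le> Re s \<longrightarrow> poly (cpoly b) s \<noteq> 0"
    "\<forall>s. ratfun_eval r s = poly (cpoly a) s / poly (cpoly b) s"
    using stable_ratfunE[OF assms(1)] .
  have ev: "ratfun_eval r = (\<lambda>s. poly (cpoly a) s / poly (cpoly b) s)"
    using r(5) by auto
  show "ratfun_eval r holomorphic_on {s. Re s > 0}"
    unfolding ev using r(4) by (intro holomorphic_intros) auto
  show "continuous_on {s. Re s \<ge> 0} (ratfun_eval r)"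
    unfolding ev using r(4) by (intro continuous_intros) auto
qed

section \<open>Matrices over the stable proper rational functions\<close>

lemma RH_inf_iff: "R \<in> RH_inf \<longleftrightarrow> (\<forall>i j. R $ i $ j \<in> stable_ratfun)"
  by (auto simp: RH_inf_def stable_ratfun_def)

lemma tf_eval_nth [simp]: "tf_eval R s $ i $ j = ratfun_eval (R $ i $ j) s"
  by (simp add: tf_eval_def ratfun_eval_def)

lemma RH_inf_mult:
  fixes A B :: "ratfun ^ 'n ^ 'n"
  assumes "A \<in> RH_inf" "B \<in> RH_inf"
  shows "A ** B \<in> RH_inf"
    and "0 \<le> Re s \<Longrightarrow> tf_eval (A ** B) s = tf_eval A s ** tf_eval B s"
proof -
  have A: "A $ i $ j \<in> stable_ratfun" and B: "B $ i $ j \<in> stable_ratfun" for i j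
    using assms by (simp_all add: RH_inf_iff)
  have eq: "(A ** B) $ i $ j = (\<Sum>k\<in>UNIV. A $ i $ k * B $ k $ j)" for i j
    by (simp only: matrix_matrix_mult_def vec_lambda_beta)
  show "A ** B \<in> RH_inf"
    unfolding RH_inf_iff eq by (intro allI stable_ratfun_sum(1) stable_ratfun_mult(1) A B)
  show "tf_eval (A ** B) s = tf_eval A s ** tf_eval B s" if "0 \<le> Re s"
  proof -
    have "ratfun_eval ((A ** B) $ i $ j) s = (tf_eval A s ** tf_eval B s) $ i $ j" for i j
    proof -
      have "ratfun_eval ((A ** B) $ i $ j) s = (\<Sum>k\<in>UNIV. ratfun_eval (A $ i $ k * B $ k $ j) s)"
        unfolding eq by (intro stable_ratfun_sum(2) stable_ratfun_mult(1) A B that)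
      also have "\<dots> = (\<Sum>k\<in>UNIV. ratfun_eval (A $ i $ k) s * ratfun_eval (B $ k $ j) s)"
        by (intro sum.cong refl stable_ratfun_mult(2) A B that)
      finally show ?thesis by (simp only: matrix_matrix_mult_def vec_lambda_beta tf_eval_nth)
    qed
    then show ?thesis unfolding vec_eq_iff by (simp only: tf_eval_nth simp_thms)
  qed
qed

lemma RH_inf_add:
  fixes A B :: "ratfun ^ 'n ^ 'n"
  assumes "A \<in> RH_inf" "B \<in> RH_inf"
  shows "A + B \<in> RH_inf"
  using assms unfolding RH_inf_iff vector_add_component by (intro allI stable_ratfun_add(1)) simp_all

lemma RH_inf_diff:
  fixes A B :: "ratfun ^ 'n ^ 'n"
  assumes "A \<in> RH_inf" "B \<in> RH_inf"
  shows "A - B \<in> RH_inf"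
    and "0 \<le> Re s \<Longrightarrow> tf_eval (A - B) s = tf_eval A s - tf_eval B s"
proof -
  have eq: "(A - B) $ i $ j = A $ i $ j + - (B $ i $ j)" for i j
    by (metis vector_minus_component add_uminus_conv_diff)
  have A: "A $ i $ j \<in> stable_ratfun" and B: "B $ i $ j \<in> stable_ratfun" for i j
    using assms by (simp_all add: RH_inf_iff)
  show "A - B \<in> RH_inf"
    unfolding RH_inf_iff eq by (intro allI stable_ratfun_add(1) stable_ratfun_uminus(1) A B)
  show "tf_eval (A - B) s = tf_eval A s - tf_eval B s" if "0 \<le> Re s"
    unfolding vec_eq_iff tf_eval_nth vector_minus_component[of "tf_eval A s"] eq
    using that
    by (simp only: stable_ratfun_add(2) stable_ratfun_uminus stable_ratfun_uminus(2) A B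
       vector_minus_component tf_eval_nth) simp
qed

lemma RH_inf_mat_1: "mat 1 \<in> RH_inf"
  unfolding RH_inf_iff mat_def using stable_ratfun_0 stable_ratfun_1 by simp

lemma tf_eval_mat_1: "tf_eval (mat 1) s = mat 1"
  unfolding vec_eq_iff tf_eval_nth by (simp add: mat_def ratfun_eval_0 ratfun_eval_1)

lemma stable_ratfun_det:
  fixes A :: "ratfun ^ 'n ^ 'n"
  assumes "A \<in> RH_inf"
  shows "det A \<in> stable_ratfun"
    and "0 \<le> Re s \<Longrightarrow> ratfun_eval (det A) s = det (tf_eval A s)"
proof -
  have neg_1: "(- 1 :: ratfun) = Fract [:- 1:] 1"
    by (simp add: One_fract_def pCons_one[symmetric])
  have sgn: "(of_int (sign p) :: ratfun) \<in> stable_ratfun \<and>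
      ratfun_eval (of_int (sign p)) s = of_int (sign p)" for p :: "'n \<Rightarrow> 'n"
    using stable_ratfun_const[of "-1"] ratfun_eval_const[of "-1" s]
    by (auto simp: sign_def stable_ratfun_1 ratfun_eval_1 neg_1)
  have A: "A $ i $ j \<in> stable_ratfun" for i j
    using assms by (simp add: RH_inf_iff)
  show "det A \<in> stable_ratfun"
    unfolding det_def
    by (intro stable_ratfun_sum stable_ratfun_mult stable_ratfun_prod A conjunct1[OF sgn])
  have "ratfun_eval (det A) s = (\<Sum>p | p permutes UNIV.
      ratfun_eval (of_int (sign p) * (\<Prod>i\<in>UNIV. A $ i $ p i)) s)" if "0 \<le> Re s"
    unfolding det_def using that
    by (intro stable_ratfun_sum(2) stable_ratfun_mult stable_ratfun_prod A conjunct1[OF sgn])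
  also have "\<dots> = det (tf_eval A s)" if "0 \<le> Re s"
    unfolding det_def
  proof (rule sum.cong[OF refl])
    fix p :: "'n \<Rightarrow> 'n"
    show "ratfun_eval (of_int (sign p) * (\<Prod>i\<in>UNIV. A $ i $ p i)) s =
        of_int (sign p) * (\<Prod>i\<in>UNIV. tf_eval A s $ i $ p i)"
      using that sgn[of p] by (simp add: stable_ratfun_mult(2) stable_ratfun_prod A)
  qed
  finally show "0 \<le> Re s \<Longrightarrow> ratfun_eval (det A) s = det (tf_eval A s)" .
qed

section \<open>Hermitian matrices and their maximum eigenvalue\<close>

text \<open>
  Positivity of forms is used only through real parts, so the complex space is treated as a real inner
  product space, and a Hermitian matrix as a real-linear self-adjoint operator on it.
\<close>

lemma psd_Cauchy_Schwarz:
  fixes P :: "'a::real_inner \<Rightarrow> 'a"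
  assumes "linear P" and self: "\<And>x y. x \<bullet> P y = P x \<bullet> y" and psd: "\<And>x. 0 \<le> x \<bullet> P x"
  shows "(x \<bullet> P y)\<^sup>2 \<le> (x \<bullet> P x) * (y \<bullet> P y)"
proof -
  have poly: "0 \<le> x \<bullet> P x + 2 * t * (x \<bullet> P y) + t\<^sup>2 * (y \<bullet> P y)" for t
  proof -
    have yx: "y \<bullet> P x = x \<bullet> P y"
      by (metis self inner_commute)
    have P: "P (x + t *\<^sub>R y) = P x + t *\<^sub>R P y"
      by (simp only: linear_add[OF \<open>linear P\<close>] linear_scale[OF \<open>linear P\<close>])
    have "(x + t *\<^sub>R y) \<bullet> P (x + t *\<^sub>R y)
        = x \<bullet> P x + t * (y \<bullet> P x) + t * (x \<bullet> P y + t * (y \<bullet> P y))"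
      unfolding P by (simp only: inner_add_left inner_add_right inner_scaleR_left inner_scaleR_right)
    also have "\<dots> = x \<bullet> P x + 2 * t * (x \<bullet> P y) + t\<^sup>2 * (y \<bullet> P y)"
      unfolding yx by algebra
    finally show ?thesis using psd by metis
  qed
  show ?thesis
  proof (cases "y \<bullet> P y = 0")
    case True
    have "x \<bullet> P y = 0"
    proof (rule ccontr)
      define b where "b = x \<bullet> P y"
      assume "x \<bullet> P y \<noteq> 0"
      then have "2 * (- (x \<bullet> P x + 1) / (2 * b)) * b = - (x \<bullet> P x + 1)"
        by (simp add: b_def)
      then show False
        using poly[of "- (x \<bullet> P x + 1) / (2 * b)"] unfolding True b_def[symmetric] by linarith
    qed
    then show ?thesis using True by simp
  next
    case False
    define b c where "b = x \<bullet> P y" and "c = y \<bullet> P y"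
    have c: "0 < c" using False psd[of y] by (simp add: c_def)
    have "2 * (- b / c) * b + (- b / c)\<^sup>2 * c = - (b\<^sup>2 / c)"
      using c by (simp add: power2_eq_square)
    then have "b\<^sup>2 / c \<le> x \<bullet> P x"
      using poly[of "- b / c"] unfolding b_def[symmetric] c_def[symmetric] by linarith
    then show ?thesis
      using c unfolding b_def[symmetric] c_def[symmetric] by (simp add: pos_divide_le_eq)
  qed
qed

lemma psd_form_eq_0:
  fixes P :: "'a::real_inner \<Rightarrow> 'a"
  assumes "linear P" "\<And>x y. x \<bullet> P y = P x \<bullet> y" "\<And>x. 0 \<le> x \<bullet> P x" and "v \<bullet> P v = 0"
  shows "P v = 0"
proof -
  have "(P v \<bullet> P v)\<^sup>2 \<le> (P v \<bullet> P (P v)) * (v \<bullet> P v)"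
    by (rule psd_Cauchy_Schwarz[OF assms(1-3)])
  then show ?thesis using assms(4) by simp
qed

text \<open>
  Both parts of \<open>x\<^sup>* A x\<close> are real inner products: multiplication by \<open>\<i>\<close> in the first argument
  exchanges real and imaginary parts.
\<close>

lemma Re_quad_form: "Re (quad_form A x) = x \<bullet> (A *v x)"
  by (simp add: quad_form_def inner_vec_def inner_complex_def)

lemma Im_quad_form: "Im (quad_form A x) = (\<i> *s x) \<bullet> (A *v x)"
  by (simp add: quad_form_def inner_vec_def inner_complex_def algebra_simps)

lemma of_real_vector_mult: "complex_of_real c *s v = c *\<^sub>R v"
  by (simp add: vec_eq_iff complex_eq_iff)

lemma linear_complex_matrix: "linear ((*v) (A :: complex ^ 'n ^ 'm))"
proof (rule linearI)
  fix x y :: "complex ^ 'n" and c :: real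
  show "A *v (x + y) = A *v x + A *v y" by (rule matrix_vector_right_distrib)
  show "A *v (c *\<^sub>R x) = c *\<^sub>R (A *v x)"
    by (simp add: vector_scalar_commute flip: of_real_vector_mult)
qed

lemma inner_conj_transpose:
  fixes A :: "complex ^ 'n ^ 'n"
  shows "x \<bullet> (A *v y) = (conj_transpose A *v x) \<bullet> y"
proof -
  have "x \<bullet> (A *v y) = (\<Sum>i\<in>UNIV. \<Sum>j\<in>UNIV. x $ i \<bullet> (A $ i $ j * y $ j))"
    by (simp add: inner_vec_def matrix_vector_mult_def inner_sum_right)
  also have "\<dots> = (\<Sum>j\<in>UNIV. \<Sum>i\<in>UNIV. x $ i \<bullet> (A $ i $ j * y $ j))"
    by (rule sum.swap)
  also have "\<dots> = (\<Sum>j\<in>UNIV. \<Sum>i\<in>UNIV. (cnj (A $ i $ j) * x $ i) \<bullet> y $ j)"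
    by (simp add: inner_complex_def algebra_simps)
  also have "\<dots> = (conj_transpose A *v x) \<bullet> y"
    by (simp add: inner_vec_def matrix_vector_mult_def inner_sum_left conj_transpose_def)
  finally show ?thesis .
qed

lemma inner_i_scalar_mult: "(\<i> *s x) \<bullet> (k *s x) = Im k * (x \<bullet> x)" for x :: "complex ^ 'n"
  by (simp add: inner_vec_def inner_complex_def sum_distrib_left algebra_simps)

lemma Hermitian_eigenvalue_real:
  fixes A :: "complex ^ 'n ^ 'n"
  assumes "conj_transpose A = A" "A *v v = z *s v" "v \<noteq> 0"
  shows "Im z = 0"
proof -
  have "(\<i> *s v) \<bullet> (A *v v) = (A *v (\<i> *s v)) \<bullet> v"
    using inner_conj_transpose[of "\<i> *s v" A v] assms(1) by simp
  also have "\<dots> = (\<i> *s (A *v v)) \<bullet> v"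
    by (simp add: vector_scalar_commute)
  finally have "(\<i> *s v) \<bullet> (z *s v) = (\<i> *s (z *s v)) \<bullet> v"
    using assms(2) by simp
  moreover have "(\<i> *s v) \<bullet> (z *s v) = Im z * (v \<bullet> v)"
    by (rule inner_i_scalar_mult)
  moreover have "(\<i> *s (z *s v)) \<bullet> v = - Im z * (v \<bullet> v)"
    by (simp add: inner_vec_def inner_complex_def sum_distrib_left algebra_simps sum_negf
        flip: sum.distrib)
  ultimately show ?thesis using assms(3) by simp
qed

lemma Hermitian_finite_eigenvalues:
  fixes A :: "complex ^ 'n ^ 'n"
  assumes herm: "conj_transpose A = A"
  shows "finite (eigenvalues A)"
proof -
  define f where "f z = (SOME v. v \<noteq> 0 \<and> A *v v = z *s v)" for z
  have f: "f z \<noteq> 0 \<and> A *v f z = z *s f z" if "z \<in> eigenvalues A" for z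
    unfolding f_def using that by (intro someI_ex[of "\<lambda>v. v \<noteq> 0 \<and> A *v v = z *s v"]) (simp add: eigenvalues_def)
  have real: "z = complex_of_real (Re z)" if "z \<in> eigenvalues A" for z
    using Hermitian_eigenvalue_real[OF herm, of "f z" z] f[OF that] by (simp add: complex_eq_iff)
  have orth: "f z \<bullet> f w = 0" if "z \<in> eigenvalues A" "w \<in> eigenvalues A" "z \<noteq> w" for z w
  proof -
    have "f z \<bullet> (A *v f w) = (A *v f z) \<bullet> f w"
      using inner_conj_transpose[of "f z" A "f w"] herm by simp
    moreover have "A *v f w = Re w *\<^sub>R f w" "A *v f z = Re z *\<^sub>R f z"
      using f that real of_real_vector_mult by metis+
    ultimately have "(Re w - Re z) * (f z \<bullet> f w) = 0"
      by (simp add: algebra_simps)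
    moreover have "Re w \<noteq> Re z" using real that by metis
    ultimately show ?thesis by simp
  qed
  have "inj_on f (eigenvalues A)"
    using orth f by (metis inj_onI inner_eq_zero_iff)
  moreover have "finite (f ` eigenvalues A)"
    by (rule pairwise_orthogonal_imp_finite) (use orth in \<open>auto simp: pairwise_def orthogonal_def\<close>)
  ultimately show ?thesis by (rule finite_imageD[rotated])
qed

text \<open>
  Rayleigh's principle: the maximum \<open>b\<close> of the form on the unit sphere is an eigenvalue, since
  \<open>b I - A\<close> is positive semidefinite and its form vanishes at a maximizer.
\<close>

lemma Hermitian_max_eigenvalue:
  fixes A :: "complex ^ 'n ^ 'n"
  assumes herm: "conj_transpose A = A"
  shows "x \<bullet> (A *v x) \<le> max_eigenvalue A * (x \<bullet> x)"
    and "\<exists>v. v \<noteq> 0 \<and> A *v v = max_eigenvalue A *\<^sub>R v"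
proof -
  let ?S = "sphere (0 :: complex ^ 'n) 1"
  have cont: "continuous_on ?S (\<lambda>x. x \<bullet> (A *v x))"
    by (intro continuous_intros linear_continuous_on linear_linear[THEN iffD2] linear_complex_matrix)
  have "?S \<noteq> {}"
    using vector_choose_size[of 1] by (auto simp: set_eq_iff)
  then obtain v where v: "v \<in> ?S" and max: "\<And>x. x \<in> ?S \<Longrightarrow> x \<bullet> (A *v x) \<le> v \<bullet> (A *v v)"
    using continuous_attains_sup[OF compact_sphere _ cont] by blast
  define b where "b = v \<bullet> (A *v v)"
  have "v \<noteq> 0" using v by auto
  have vv: "v \<bullet> v = 1" using v by (simp add: norm_eq_1)
  have bound: "x \<bullet> (A *v x) \<le> b * (x \<bullet> x)" for x
  proof (cases "x = 0")
    case False
    let ?u = "x /\<^sub>R norm x"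
    have "?u \<bullet> (A *v ?u) \<le> b"
      unfolding b_def using False by (intro max) simp
    then have "(x \<bullet> (A *v x)) / (norm x)\<^sup>2 \<le> b"
      by (simp add: linear_scale[OF linear_complex_matrix] power2_eq_square field_simps)
    then show ?thesis using False by (simp add: divide_le_eq power2_norm_eq_inner)
  qed simp
  define P where "P x = b *\<^sub>R x - A *v x" for x
  have "linear P"
    unfolding P_def by (intro linear_compose_sub linear_complex_matrix linear_scaleR)
  then have "P v = 0"
  proof (rule psd_form_eq_0)
    show "x \<bullet> P y = P x \<bullet> y" for x y
      using inner_conj_transpose[of x A y] herm by (simp add: P_def algebra_simps)
    show "0 \<le> x \<bullet> P x" for x
      using bound by (simp add: P_def algebra_simps)
    show "v \<bullet> P v = 0"
      by (simp add: P_def algebra_simps vv b_def)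
  qed
  then have eig: "A *v v = b *\<^sub>R v" by (simp add: P_def)
  have "max_eigenvalue A = b"
    unfolding max_eigenvalue_def
  proof (rule Max_eqI)
    show "finite (Re ` eigenvalues A)"
      using Hermitian_finite_eigenvalues[OF herm] by simp
    have "complex_of_real b \<in> eigenvalues A"
      using eig \<open>v \<noteq> 0\<close> by (auto simp: eigenvalues_def of_real_vector_mult)
    then show "b \<in> Re ` eigenvalues A" by force
    fix r assume "r \<in> Re ` eigenvalues A"
    then obtain z w where z: "r = Re z" "w \<noteq> 0" "A *v w = z *s w"
      by (auto simp: eigenvalues_def)
    then have "z = complex_of_real r"
      using Hermitian_eigenvalue_real[OF herm] by (simp add: complex_eq_iff)
    then have "A *v w = r *\<^sub>R w"
      using z(3) of_real_vector_mult by metis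
    then have "r * (w \<bullet> w) \<le> b * (w \<bullet> w)"
      using bound[of w] by simp
    then show "r \<le> b" using z(2) by simp
  qed
  then show "x \<bullet> (A *v x) \<le> max_eigenvalue A * (x \<bullet> x)"
    and "\<exists>v. v \<noteq> 0 \<and> A *v v = max_eigenvalue A *\<^sub>R v"
    using bound eig \<open>v \<noteq> 0\<close> by auto
qed

text \<open>
  For positive semidefinite \<open>A\<close> this says \<open>A\<^sup>2 \<le> \<lambda> A\<close> with \<open>\<lambda>\<close> the maximum eigenvalue; the
  Cauchy--Schwarz inequality replaces the square root of \<open>A\<close>.
\<close>

lemma psd_norm_bound:
  fixes A :: "complex ^ 'n ^ 'n"
  assumes herm: "conj_transpose A = A" and psd: "\<And>x. 0 \<le> x \<bullet> (A *v x)"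
  shows "(A *v x) \<bullet> (A *v x) \<le> max_eigenvalue A * (x \<bullet> (A *v x))"
proof -
  let ?y = "A *v x"
  have "(?y \<bullet> (A *v x))\<^sup>2 \<le> (?y \<bullet> (A *v ?y)) * (x \<bullet> (A *v x))"
    using psd_Cauchy_Schwarz[OF linear_complex_matrix[of A], of ?y x]
      inner_conj_transpose[of _ A] herm psd by simp
  also have "\<dots> \<le> (max_eigenvalue A * (?y \<bullet> ?y)) * (x \<bullet> (A *v x))"
    by (intro mult_right_mono Hermitian_max_eigenvalue herm psd)
  finally have "(?y \<bullet> ?y) * (?y \<bullet> ?y) \<le> (?y \<bullet> ?y) * (max_eigenvalue A * (x \<bullet> (A *v x)))"
    by (simp add: power2_eq_square mult_ac)
  then show ?thesis
    by (cases "?y = 0") (auto simp: mult_le_cancel_left_pos)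
qed

section \<open>Two consequences of the maximum principle\<close>

text \<open>
  A homotopy of holomorphic functions on the disc that never vanish on the circle cannot acquire a
  zero inside. While \<open>f t\<close> is free of zeros, the maximum principle for \<open>1 / f t\<close> bounds \<open>\<bar>f t\<bar>\<close> on the
  disc below by its minimum \<open>m\<close> on the cylinder \<open>[0,1] \<times> circle\<close>; by uniform continuity the
  absence of zeros then persists over a step in \<open>t\<close> whose length does not depend on \<open>t\<close>.
\<close>

lemma zero_free_homotopy:
  fixes f :: "real \<Rightarrow> complex \<Rightarrow> complex"
  assumes cont: "continuous_on ({0..1} \<times> cball 0 1) (\<lambda>(t, z). f t z)"
    and holo: "\<And>t. t \<in> {0..1} \<Longrightarrow> f t holomorphic_on ball 0 1"
    and circle: "\<And>t z. \<lbrakk>t \<in> {0..1}; z \<in> sphere 0 1\<rbrakk> \<Longrightarrow> f t z \<noteq> 0"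
    and start: "\<And>z. z \<in> cball 0 1 \<Longrightarrow> f 0 z \<noteq> 0"
    and t: "t \<in> {0..1}" and z: "z \<in> cball 0 1"
  shows "f t z \<noteq> 0"
proof -
  have cont': "continuous_on ({0..1} \<times> sphere 0 1) (\<lambda>p. norm (case p of (t, z) \<Rightarrow> f t z))"
    by (intro continuous_on_norm continuous_on_subset[OF cont]) auto
  have "compact ({0..1::real} \<times> sphere (0::complex) 1)" "{0..1::real} \<times> sphere (0::complex) 1 \<noteq> {}"
    using t by (auto intro!: compact_Times simp: sphere_eq_empty)
  then obtain p where p: "p \<in> {0..1} \<times> sphere 0 1"
      "\<And>q. q \<in> {0..1} \<times> sphere 0 1 \<Longrightarrow>
        norm (case p of (t, z) \<Rightarrow> f t z) \<le> norm (case q of (t, z) \<Rightarrow> f t z)"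
    using continuous_attains_inf[OF _ _ cont'] by blast
  define m where "m = norm (case p of (t, z) \<Rightarrow> f t z)"
  have "0 < m"
    using p(1) circle by (auto simp: m_def)
  have m: "m \<le> norm (f t z)" if "t \<in> {0..1}" "z \<in> sphere 0 1" for t z
    using p(2)[of "(t, z)"] that by (simp add: m_def)
  define good where "good t \<longleftrightarrow> (\<forall>z\<in>cball 0 1. f t z \<noteq> 0)" for t
  have lower: "m \<le> norm (f t z)" if "t \<in> {0..1}" "good t" "z \<in> cball 0 1" for t z
  proof -
    have nz: "f t w \<noteq> 0" if "w \<in> cball 0 1" for w
      using \<open>good t\<close> that by (simp add: good_def)
    have ct: "continuous_on (cball 0 1) (f t)"
    proof -
      have "continuous_on (cball 0 1) (\<lambda>z. case (t, z) of (t, z) \<Rightarrow> f t z)"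
        by (rule continuous_on_compose2[OF cont]) (use \<open>t \<in> {0..1}\<close> in \<open>auto intro: continuous_intros\<close>)
      then show ?thesis by simp
    qed
    have "norm (inverse (f t z)) \<le> inverse m"
    proof (rule maximum_modulus_frontier[where S = "cball 0 1" and f = "\<lambda>z. inverse (f t z)" and \<xi> = z])
      show "(\<lambda>z. inverse (f t z)) holomorphic_on interior (cball 0 1)"
        using nz holo[OF \<open>t \<in> {0..1}\<close>] by (auto intro!: holomorphic_on_inverse)
      show "continuous_on (closure (cball 0 1)) (\<lambda>z. inverse (f t z))"
        using nz ct by (auto intro!: continuous_on_inverse)
      show "norm (inverse (f t w)) \<le> inverse m" if "w \<in> frontier (cball 0 1)" for w
        using m[OF \<open>t \<in> {0..1}\<close>, of w] that \<open>0 < m\<close>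
        by (simp add: norm_inverse frontier_cball le_imp_inverse_le)
    qed (use \<open>z \<in> cball 0 1\<close> in auto)
    then show ?thesis
      using nz[OF that(3)] \<open>0 < m\<close> by (simp add: norm_inverse inverse_le_iff_le)
  qed
  have "uniformly_continuous_on ({0..1} \<times> cball 0 1) (\<lambda>(t, z). f t z)"
    by (intro compact_uniformly_continuous cont compact_Times) auto
  then obtain \<delta> where "\<delta> > 0" and \<delta>: "\<And>p q. \<lbrakk>p \<in> {0..1} \<times> cball 0 1; q \<in> {0..1} \<times> cball 0 1;
      dist q p < \<delta>\<rbrakk> \<Longrightarrow> dist (case q of (t, z) \<Rightarrow> f t z) (case p of (t, z) \<Rightarrow> f t z) < m"
    unfolding uniformly_continuous_on_def using \<open>0 < m\<close> by metis
  have step: "good t'" if "t \<in> {0..1}" "good t" "t' \<in> {0..1}" "\<bar>t' - t\<bar> < \<delta>" for t t'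
    unfolding good_def
  proof
    fix z :: complex assume z: "z \<in> cball 0 1"
    have "dist (f t' z) (f t z) < m"
      using \<delta>[of "(t, z)" "(t', z)"] that z by (auto simp: dist_Pair_Pair dist_real_def)
    then show "f t' z \<noteq> 0"
      using lower[OF that(1,2) z] by (auto simp: dist_norm)
  qed
  obtain N :: nat where "N > 0" and N: "inverse (real N) < \<delta>"
    using \<open>\<delta> > 0\<close> real_arch_inverse[of \<delta>] by auto
  have "good (t * (real k / real N))" if "k \<le> N" for k
    using that
  proof (induction k)
    case 0
    then show ?case using start by (simp add: good_def)
  next
    case (Suc k)
    have frac: "t * (real j / real N) \<in> {0..1}" if "j \<le> N" for j
    proof -
      have "0 \<le> real j / real N" "real j / real N \<le> 1"
        using that \<open>N > 0\<close> by simp_all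
      then show ?thesis
        using t mult_le_one[of t "real j / real N"] mult_nonneg_nonneg[of t "real j / real N"]
        by (simp del: times_divide_eq_right)
    qed
    have "t * (real (Suc k) / real N) - t * (real k / real N) = t * inverse (real N)"
      using \<open>N > 0\<close> by (simp add: field_simps)
    moreover have "\<bar>t * inverse (real N)\<bar> \<le> inverse (real N)"
      using t mult_right_mono[of t 1 "inverse (real N)"] by (simp add: abs_mult)
    ultimately have "\<bar>t * (real (Suc k) / real N) - t * (real k / real N)\<bar> < \<delta>"
      using N by linarith
    then show ?case
      using Suc step[OF frac _ frac] by (meson Suc_leD)
  qed
  from this[of N] have "good t" using \<open>N > 0\<close> by simp
  then show ?thesis using z by (simp add: good_def)
qed

text \<open>
  The maximum principle for the imaginary part on a quarter disc whose radius \<open>R\<close> is so large that \<open>h\<close>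
  is close to its real limit on the arc.
\<close>

lemma Im_nonpos_first_quadrant:
  fixes h :: "complex \<Rightarrow> complex"
  assumes cont: "continuous_on {s. 0 \<le> Re s} h" and holo: "h holomorphic_on {s. 0 < Re s}"
    and lim: "(h \<longlongrightarrow> l) at_infinity" and l: "Im l = 0"
    and real: "\<And>x. 0 \<le> x \<Longrightarrow> Im (h (complex_of_real x)) = 0"
    and imag: "\<And>w. 0 < w \<Longrightarrow> Im (h (\<i> * complex_of_real w)) \<le> 0"
    and s: "0 \<le> Re s" "0 \<le> Im s"
  shows "Im (h s) \<le> 0"
proof -
  have bdry: "Im (h z) \<le> 0" if "0 \<le> Re z" "0 \<le> Im z" "Re z = 0 \<or> Im z = 0" for z
  proof (cases "Im z = 0")
    case True
    then have "z = complex_of_real (Re z)" by (simp add: complex_eq_iff)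
    then show ?thesis using real[OF that(1)] by simp
  next
    case False
    then have "z = \<i> * complex_of_real (Im z)" "0 < Im z"
      using that by (auto simp: complex_eq_iff)
    then show ?thesis using imag[of "Im z"] by simp
  qed
  show ?thesis
  proof (cases "Re s = 0 \<or> Im s = 0")
    case True
    then show ?thesis using bdry s by blast
  next
    case False
    then have s': "0 < Re s" "0 < Im s" using s by auto
    show ?thesis
    proof (rule field_le_epsilon)
      fix e :: real assume "0 < e"
      then obtain B where B: "\<And>z. B \<le> norm z \<Longrightarrow> dist (h z) l < e"
        using lim unfolding tendsto_iff eventually_at_infinity by meson
      define R where "R = max B (norm s + 1)"
      define S where "S = {z. 0 < Re z} \<inter> {z. 0 < Im z} \<inter> ball 0 R"
      have "open S"
        unfolding S_def by (intro open_Int open_halfspace_Re_gt open_halfspace_Im_gt open_ball)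
      have "closure S \<subseteq> {z. 0 \<le> Re z} \<inter> {z. 0 \<le> Im z} \<inter> cball 0 R"
        by (rule closure_minimal)
          (auto simp: S_def intro!: closed_Int closed_halfspace_Re_ge closed_halfspace_Im_ge)
      then have cl: "0 \<le> Re z" "0 \<le> Im z" "norm z \<le> R" if "z \<in> closure S" for z
        using that by auto
      have "Re (- \<i> * h s) \<le> e"
      proof (rule maximum_real_frontier[where S = S and f = "\<lambda>z. - \<i> * h z" and \<xi> = s])
        show "(\<lambda>z. - \<i> * h z) holomorphic_on interior S"
          unfolding interior_open[OF \<open>open S\<close>]
          by (intro holomorphic_intros holomorphic_on_subset[OF holo]) (auto simp: S_def)
        show "continuous_on (closure S) (\<lambda>z. - \<i> * h z)"
          using cl by (intro continuous_intros continuous_on_subset[OF cont]) auto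
        show "bounded S" unfolding S_def by (intro bounded_Int) auto
        show "s \<in> S" using s' by (simp add: S_def R_def)
        fix z assume z: "z \<in> frontier S"
        then have z': "z \<in> closure S" "z \<notin> S"
          using \<open>open S\<close> by (auto simp: frontier_def interior_open)
        show "Re (- \<i> * h z) \<le> e"
        proof (cases "norm z = R")
          case True
          then have "dist (h z) l < e" using B by (simp add: R_def)
          then have "\<bar>Im (h z - l)\<bar> < e"
            using abs_Im_le_cmod[of "h z - l"] by (simp add: dist_norm)
          then show ?thesis using l by simp
        next
          case False
          then have "Re z = 0 \<or> Im z = 0"
            using cl[OF z'(1)] z'(2) by (auto simp: S_def)
          then show ?thesis using bdry[of z] cl[OF z'(1)] \<open>0 < e\<close> by simp
        qed
      qed
      then show "Im (h s) \<le> 0 + e" by simp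
    qed
  qed
qed

text \<open>
  The scalar form of the statement that the DC gain of a strictly negative imaginary system exceeds
  its gain at infinity. On the positive real axis \<open>h\<close> is real, and \<open>Im h \<le> 0\<close> just above it, so by the
  Cauchy--Riemann equations \<open>h\<close> is nonincreasing there. If the values at \<open>0\<close> and at infinity
  agreed, \<open>h\<close> would be constant on the axis, hence everywhere, contrary to \<open>Im h < 0\<close> on the
  imaginary axis.
\<close>

lemma dc_gain_greater:
  fixes h :: "complex \<Rightarrow> complex"
  assumes cont: "continuous_on {s. 0 \<le> Re s} h" and holo: "h holomorphic_on {s. 0 < Re s}"
    and lim: "(h \<longlongrightarrow> l) at_infinity"
    and real: "\<And>x. 0 \<le> x \<Longrightarrow> Im (h (complex_of_real x)) = 0"
    and imag: "\<And>w. 0 < w \<Longrightarrow> Im (h (\<i> * complex_of_real w)) < 0"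
  shows "Re l < Re (h 0)"
proof -
  define g where "g x = Re (h (complex_of_real x))" for x
  have hg: "h (complex_of_real x) = complex_of_real (g x)" if "0 \<le> x" for x
    using real[OF that] by (simp add: g_def complex_eq_iff)
  have lim_real: "((\<lambda>x. h (complex_of_real x)) \<longlongrightarrow> l) at_top"
    by (rule filterlim_compose[OF lim filterlim_of_real_at_infinity])
  have "((\<lambda>x. Im (h (complex_of_real x))) \<longlongrightarrow> Im l) at_top"
    by (intro tendsto_intros lim_real)
  moreover have "((\<lambda>x. Im (h (complex_of_real x))) \<longlongrightarrow> 0) at_top"
    by (rule tendsto_eventually) (use real in \<open>auto simp: eventually_at_top_linorder intro: exI[of _ 0]\<close>)
  ultimately have l: "Im l = 0" by (rule tendsto_unique[rotated 1]) simp
  have quad: "Im (h s) \<le> 0" if "0 \<le> Re s" "0 \<le> Im s" for s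
    using Im_nonpos_first_quadrant[OF cont holo lim l real _ that] imag by (meson less_imp_le)
  have deriv: "\<exists>d. (g has_real_derivative d) (at x) \<and> d \<le> 0" if x: "0 < x" for x
  proof -
    have "\<exists>d. (h has_field_derivative d) (at (complex_of_real x))"
      using holo x holomorphic_on_open[OF open_halfspace_Re_gt, of h 0] by simp
    then obtain d where d: "(h has_field_derivative d) (at (complex_of_real x))" ..
    have "((\<lambda>t. h (complex_of_real t)) has_vector_derivative d) (at x)"
      using has_vector_derivative_real_field[OF d] by simp
    then have gd: "(g has_real_derivative Re d) (at x)"
      unfolding g_def by (rule has_field_derivative_Re)
    \<comment> \<open>The vertical derivative of \<open>Im h\<close> is \<open>Im (\<i> d) = Re d\<close>.\<close>
    have "Re d \<le> 0"
    proof (rule ccontr)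
      assume "\<not> Re d \<le> 0"
      have "((\<lambda>t. complex_of_real x + \<i> * complex_of_real t) has_vector_derivative \<i>) (at 0)"
        by (auto intro!: derivative_eq_intros)
      then have "((\<lambda>t. h (complex_of_real x + \<i> * complex_of_real t)) has_vector_derivative \<i> * d) (at 0)"
        using field_vector_diff_chain_at[of "\<lambda>t. complex_of_real x + \<i> * complex_of_real t" \<i> 0 h d] d by (simp add: o_def)
      then have "((\<lambda>t. Im (h (complex_of_real x + \<i> * complex_of_real t))) has_real_derivative
          Im (\<i> * d)) (at 0)"
        by (rule has_field_derivative_Im)
      then obtain e where "e > 0" and e: "\<And>t. \<lbrakk>0 < t; t < e\<rbrakk> \<Longrightarrow>
          Im (h (complex_of_real x + \<i> * complex_of_real 0)) <
          Im (h (complex_of_real x + \<i> * complex_of_real t))"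
        using DERIV_pos_inc_right[of "\<lambda>t. Im (h (complex_of_real x + \<i> * complex_of_real t))" "Im (\<i> * d)" 0]
          \<open>\<not> Re d \<le> 0\<close> by auto
      from e[of "e / 2"] \<open>e > 0\<close> have "0 < Im (h (complex_of_real x + \<i> * complex_of_real (e / 2)))"
        using real[of x] x by simp
      then show False
        using quad[of "complex_of_real x + \<i> * complex_of_real (e / 2)"] x \<open>e > 0\<close> by simp
    qed
    then show ?thesis using gd by blast
  qed
  have mono: "g y \<le> g x" if "0 < x" "x \<le> y" for x y
    using DERIV_nonpos_imp_nonincreasing[OF that(2), of g] deriv that(1) by (meson less_le_trans)
  have upper: "g x \<le> Re (h 0)" if "0 < x" for x
  proof -
    have "((\<lambda>t. h (complex_of_real t)) \<longlongrightarrow> h 0) (at_right 0)"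
    proof -
      have "continuous_on {0..} (\<lambda>t. h (complex_of_real t))"
        by (intro continuous_on_compose2[OF cont] continuous_intros) auto
      then have "((\<lambda>t. h (complex_of_real t)) \<longlongrightarrow> h (complex_of_real 0)) (at 0 within {0..})"
        unfolding continuous_on_def by (meson atLeast_iff order_refl)
      then have "((\<lambda>t. h (complex_of_real t)) \<longlongrightarrow> h (complex_of_real 0)) (at_right 0)"
        by (rule tendsto_within_subset) auto
      then show ?thesis by simp
    qed
    then have "(g \<longlongrightarrow> Re (h 0)) (at_right 0)"
      unfolding g_def by (rule tendsto_Re)
    moreover have "\<forall>\<^sub>F t in at_right 0. g x \<le> g t"
      using eventually_at_right_less[of 0] eventually_at_right_real[OF that]
      by eventually_elim (use mono in auto)
    ultimately show ?thesis
      by (intro tendsto_lowerbound[of g]) auto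
  qed
  have lower: "Re l \<le> g x" if "0 < x" for x
  proof -
    have "(g \<longlongrightarrow> Re l) at_top"
      unfolding g_def by (intro tendsto_Re lim_real)
    moreover have "\<forall>\<^sub>F t in at_top. g t \<le> g x"
      using eventually_ge_at_top[of x] by eventually_elim (use mono that in auto)
    ultimately show ?thesis
      by (intro tendsto_upperbound[of g]) auto
  qed
  have "Re l \<noteq> Re (h 0)"
  proof
    assume eq: "Re l = Re (h 0)"
    have const: "h (complex_of_real x) - l = 0" if "0 < x" for x
      using upper[OF that] lower[OF that] eq hg[of x] that l by (simp add: complex_eq_iff)
    have "h z - l = 0" if "z \<in> {s. 0 < Re s}" for z
    proof (rule analytic_continuation[where S = "{s. 0 < Re s}" and U = "complex_of_real ` {0<..}" and \<xi> = 1
          and f = "\<lambda>z. h z - l"])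
      show "(\<lambda>z. h z - l) holomorphic_on {s. 0 < Re s}" by (intro holomorphic_intros holo)
      show "connected {s. 0 < Re s}" by (intro convex_connected convex_halfspace_Re_gt)
      show "1 islimpt complex_of_real ` {0<..}"
        unfolding islimpt_approachable
      proof (intro allI impI)
        fix e :: real assume "0 < e"
        have "complex_of_real (1 + e / 2) - 1 = complex_of_real (e / 2)"
          by simp
        then have "dist (complex_of_real (1 + e / 2)) 1 < e"
          unfolding dist_norm using \<open>0 < e\<close> by (simp del: of_real_divide)
        moreover have "complex_of_real (1 + e / 2) \<noteq> 1"
          using \<open>0 < e\<close> by (simp add: complex_eq_iff)
        moreover have "complex_of_real (1 + e / 2) \<in> complex_of_real ` {0<..}"
          using \<open>0 < e\<close> by (intro imageI) simp
        ultimately show "\<exists>x'\<in>complex_of_real ` {0<..}. x' \<noteq> 1 \<and> dist x' 1 < e"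
          by blast
      qed
    qed (use const that in \<open>auto simp: open_halfspace_Re_gt\<close>)
    then have h: "h z = l" if "0 < Re z" for z using that by simp
    have "((\<lambda>n. h (\<i> + complex_of_real (inverse (real (Suc n))))) \<longlonglongrightarrow> h \<i>)"
    proof (rule continuous_on_tendsto_compose[OF cont])
      have "(\<lambda>n. \<i> + complex_of_real (inverse (real (Suc n)))) \<longlonglongrightarrow> \<i> + complex_of_real 0"
        by (intro tendsto_intros LIMSEQ_inverse_real_of_nat)
      then show "(\<lambda>n. \<i> + complex_of_real (inverse (real (Suc n)))) \<longlonglongrightarrow> \<i>" by simp
    qed auto
    moreover have "(\<lambda>n. h (\<i> + complex_of_real (inverse (real (Suc n))))) = (\<lambda>n. l)"
      by (intro ext h) simp
    ultimately have "h \<i> = l" by (simp add: tendsto_const_iff)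
    then show False using imag[of 1] l by simp
  qed
  moreover have "Re l \<le> Re (h 0)" using upper[of 1] lower[of 1] by simp
  ultimately show ?thesis by simp
qed

section \<open>Negative imaginary transfer matrices\<close>

lemma tf_eval_tendsto:
  fixes R :: "ratfun ^ 'n ^ 'n"
  assumes "R \<in> RH_inf"
  shows "(tf_eval R \<longlongrightarrow> tf_at_infinity R) at_infinity"
proof -
  have "\<forall>i j. \<exists>l. (ratfun_eval (R $ i $ j) \<longlongrightarrow> l) at_infinity"
    using assms stable_ratfun_tendsto by (simp only: RH_inf_iff) blast
  then obtain L where L: "\<And>i j. (ratfun_eval (R $ i $ j) \<longlongrightarrow> L i j) at_infinity"
    by metis
  have "(tf_eval R \<longlongrightarrow> (\<chi> i j. L i j)) at_infinity"
    using L by (intro vec_tendstoI) (simp only: tf_eval_nth vec_lambda_beta)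
  then show ?thesis
    unfolding tf_at_infinity_def by (metis tendsto_Lim trivial_limit_at_infinity)
qed

lemma tf_eval_continuous:
  fixes R :: "ratfun ^ 'n ^ 'n"
  assumes "R \<in> RH_inf"
  shows "continuous_on {s. 0 \<le> Re s} (tf_eval R)"
proof -
  have "continuous_on {s. 0 \<le> Re s} (ratfun_eval (R $ i $ j))" for i j
    using assms by (simp only: RH_inf_iff stable_ratfun_holomorphic(2))
  then show ?thesis
    unfolding continuous_on_def by (intro ballI vec_tendstoI) (simp only: tf_eval_nth)
qed

lemma tf_eval_cnj: "tf_eval R (cnj s) $ i $ j = cnj (tf_eval R s $ i $ j)"
  by (simp only: tf_eval_nth ratfun_eval_cnj)

lemma tf_eval_real: "Im (tf_eval R (complex_of_real x) $ i $ j) = 0"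
  by (simp only: tf_eval_nth ratfun_eval_of_real)

text \<open>
  The Hermitian matrix \<open>\<i> (A - A\<^sup>*)\<close>, whose form at \<open>x\<close> is \<open>- 2 Im (x\<^sup>* A x)\<close>. Its sign at
  \<open>A = R(\<i>\<omega>)\<close> for \<open>\<omega> > 0\<close> is what defines the two classes.
\<close>

definition skew_part :: "complex ^ 'n ^ 'n \<Rightarrow> complex ^ 'n ^ 'n" where
  "skew_part A = (\<chi> a b. \<i> * (A - conj_transpose A) $ a $ b)"

lemma imag_axis_form_eq: "imag_axis_form R \<omega> = skew_part (tf_eval R (\<i> * complex_of_real \<omega>))"
  by (simp only: imag_axis_form_def skew_part_def Let_def)

lemma conj_transpose_nth [simp]: "conj_transpose A $ i $ j = cnj (A $ j $ i)"
  by (simp add: conj_transpose_def)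

lemma conj_transpose_skew_part: "conj_transpose (skew_part A) = skew_part A"
  by (simp add: skew_part_def vec_eq_iff algebra_simps)

lemma inner_i_left: "(\<i> *s x) \<bullet> y = - (x \<bullet> (\<i> *s y))" for x y :: "complex ^ 'n"
  by (simp add: inner_vec_def inner_complex_def sum_negf[symmetric] algebra_simps)

lemma skew_part_mult_vec: "skew_part A *v x = \<i> *s (A *v x) - \<i> *s (conj_transpose A *v x)"
proof -
  have "(skew_part A *v x) $ i = (\<i> *s (A *v x) - \<i> *s (conj_transpose A *v x)) $ i" for i
    by (simp add: skew_part_def matrix_vector_mult_def sum_distrib_left algebra_simps
        flip: sum_subtractf)
  then show ?thesis by (simp only: vec_eq_iff simp_thms)
qed

lemma inner_skew_part: "x \<bullet> (skew_part A *v x) = - 2 * ((\<i> *s x) \<bullet> (A *v x))"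
proof -
  have "x \<bullet> (\<i> *s (conj_transpose A *v x)) = - ((conj_transpose A *v x) \<bullet> (\<i> *s x))"
    by (metis inner_i_left inner_commute)
  also have "(conj_transpose A *v x) \<bullet> (\<i> *s x) = x \<bullet> (A *v (\<i> *s x))"
    by (simp only: inner_conj_transpose)
  also have "\<dots> = x \<bullet> (\<i> *s (A *v x))"
    by (simp only: vector_scalar_commute)
  finally show ?thesis
    unfolding skew_part_mult_vec by (simp add: inner_diff_right inner_i_left)
qed

lemma class_C_dissipative:
  assumes "R \<in> class_C" "0 < \<omega>"
  shows "(\<i> *s x) \<bullet> (tf_eval R (\<i> * complex_of_real \<omega>) *v x) \<le> 0"
proof -
  have "0 \<le> x \<bullet> (skew_part (tf_eval R (\<i> * complex_of_real \<omega>)) *v x)"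
    using assms by (auto simp: class_C_def pos_semidef_def imag_axis_form_eq Re_quad_form)
  then show ?thesis by (simp add: inner_skew_part)
qed

lemma class_Cs_dissipative:
  assumes "R \<in> class_Cs" "0 < \<omega>" "x \<noteq> 0"
  shows "(\<i> *s x) \<bullet> (tf_eval R (\<i> * complex_of_real \<omega>) *v x) < 0"
proof -
  have "0 < x \<bullet> (skew_part (tf_eval R (\<i> * complex_of_real \<omega>)) *v x)"
    using assms by (auto simp: class_Cs_def pos_def_def imag_axis_form_eq Re_quad_form)
  then show ?thesis by (simp add: inner_skew_part)
qed

lemma class_Cs_subset: "class_Cs \<subseteq> class_C"
proof
  fix R :: "ratfun ^ 'n ^ 'n" assume R: "R \<in> class_Cs"
  have "pos_semidef A" if "pos_def A" for A :: "complex ^ 'n ^ 'n"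
    unfolding pos_semidef_def
  proof (intro conjI allI)
    fix x show "0 \<le> Re (quad_form A x)"
      using that by (cases "x = 0") (auto simp: pos_def_def Re_quad_form less_imp_le)
  qed (use that in \<open>simp add: pos_def_def\<close>)
  then show "R \<in> class_C" using R by (auto simp: class_C_def class_Cs_def)
qed

lemma class_C_RH_inf: "R \<in> class_C \<Longrightarrow> R \<in> RH_inf"
  by (simp add: class_C_def)

text \<open>
  Letting \<open>\<omega>\<close> tend to \<open>0\<close> gives \<open>\<i> (R(0) - R(0)\<^sup>*) \<ge> 0\<close>. Since \<open>R(0)\<close> is real, conjugating the vector
  \<open>x\<close> changes the sign of this form, which is therefore zero.
\<close>

lemma class_C_dc_Hermitian:
  fixes R :: "ratfun ^ 'n ^ 'n"
  assumes "R \<in> class_C"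
  shows "conj_transpose (tf_eval R 0) = tf_eval R 0"
proof -
  let ?A = "tf_eval R 0"
  have real: "cnj (?A $ i $ j) = ?A $ i $ j" for i j
    using tf_eval_cnj[of R 0] by simp
  have nonpos: "(\<i> *s x) \<bullet> (?A *v x) \<le> 0" for x
  proof -
    have "((\<lambda>w. tf_eval R (\<i> * complex_of_real w)) \<longlongrightarrow> tf_eval R (\<i> * complex_of_real 0)) (at_right 0)"
    proof -
      have "continuous_on {0..} (\<lambda>w. tf_eval R (\<i> * complex_of_real w))"
        by (intro continuous_on_compose2[OF tf_eval_continuous[OF class_C_RH_inf[OF assms]]]
            continuous_intros) auto
      then have "((\<lambda>w. tf_eval R (\<i> * complex_of_real w)) \<longlongrightarrow> tf_eval R (\<i> * complex_of_real 0)) (at 0 within {0..})"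
        unfolding continuous_on_def by (meson atLeast_iff order_refl)
      then show ?thesis by (rule tendsto_within_subset) auto
    qed
    then have "((\<lambda>w. (\<i> *s x) \<bullet> (tf_eval R (\<i> * complex_of_real w) *v x)) \<longlongrightarrow> (\<i> *s x) \<bullet> (?A *v x))
        (at_right 0)"
      unfolding inner_vec_def matrix_vector_mult_def vec_lambda_beta
      by (intro tendsto_intros) simp
    moreover have "\<forall>\<^sub>F w in at_right 0. (\<i> *s x) \<bullet> (tf_eval R (\<i> * complex_of_real w) *v x) \<le> 0"
      using eventually_at_right_less[of 0]
      by eventually_elim (rule class_C_dissipative[OF assms])
    ultimately show ?thesis
      by (intro tendsto_upperbound) auto
  qed
  have zero: "(\<i> *s x) \<bullet> (?A *v x) = 0" for x
  proof -
    define c :: "complex ^ 'n \<Rightarrow> complex ^ 'n" where "c x = (\<chi> i. cnj (x $ i))" for x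
    have "?A *v c x = c (?A *v x)"
      by (simp add: vec_eq_iff c_def matrix_vector_mult_def real del: tf_eval_nth)
    then have "(\<i> *s c x) \<bullet> (?A *v c x) = - ((\<i> *s x) \<bullet> (?A *v x))"
      by (simp add: c_def inner_vec_def inner_complex_def sum_negf[symmetric] algebra_simps)
    then show ?thesis using nonpos[of x] nonpos[of "c x"] by simp
  qed
  have P: "skew_part ?A *v x = 0" for x
  proof (rule psd_form_eq_0[of "(*v) (skew_part ?A)"])
    show "y \<bullet> (skew_part ?A *v z) = (skew_part ?A *v y) \<bullet> z" for y z
      by (metis inner_conj_transpose conj_transpose_skew_part)
  qed (simp_all add: linear_complex_matrix inner_skew_part zero)
  have "skew_part ?A = 0"
    using P by (simp add: matrix_eq)
  then have "skew_part ?A $ a $ b = 0" for a b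
    by simp
  then have "(?A - conj_transpose ?A) $ a $ b = 0" for a b
    by (simp only: skew_part_def vec_lambda_beta mult_eq_0_iff complex_i_not_zero simp_thms)
  then have "?A - conj_transpose ?A = 0"
    by (simp only: vec_eq_iff zero_index simp_thms)
  then show ?thesis by simp
qed

text \<open>
  \<open>M(0) > M(\<infinity>) \<ge> 0\<close>. Only for real vectors \<open>v\<close> is \<open>v\<^sup>* M(s) v\<close> real on the real axis (\<open>M(s)\<close> need not be
  symmetric there), so the claim is proved for these first; for a complex vector the form of the
  real matrix \<open>M(0)\<close> is the sum of the forms of its real and imaginary parts.
\<close>

lemma class_Cs_dc_pos:
  fixes M :: "ratfun ^ 'n ^ 'n"
  assumes M: "M \<in> class_Cs" and inf: "pos_semidef (tf_at_infinity M)" and "x \<noteq> 0"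
  shows "0 < x \<bullet> (tf_eval M 0 *v x)"
proof -
  have RH: "M \<in> RH_inf" using M by (simp add: class_Cs_def)
  have entry: "M $ i $ j \<in> stable_ratfun" for i j using RH by (simp add: RH_inf_iff)
  have real: "0 < v \<bullet> (tf_eval M 0 *v v)" if v: "v \<noteq> 0" "\<And>i. Im (v $ i) = 0" for v
  proof -
    define h where "h s = quad_form (tf_eval M s) v" for s
    have h: "h = (\<lambda>s. \<Sum>i\<in>UNIV. cnj (v $ i) * (\<Sum>j\<in>UNIV. ratfun_eval (M $ i $ j) s * v $ j))"
      by (simp add: h_def quad_form_def matrix_vector_mult_def fun_eq_iff)
    have "Re (quad_form (tf_at_infinity M) v) < Re (h 0)"
    proof (rule dc_gain_greater)
      show "continuous_on {s. 0 \<le> Re s} h"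
        unfolding h by (intro continuous_intros stable_ratfun_holomorphic(2) entry)
      show "h holomorphic_on {s. 0 < Re s}"
        unfolding h by (intro holomorphic_intros stable_ratfun_holomorphic(1) entry)
      show "(h \<longlongrightarrow> quad_form (tf_at_infinity M) v) at_infinity"
        unfolding h_def quad_form_def matrix_vector_mult_def vec_lambda_beta
        by (intro tendsto_intros tf_eval_tendsto RH)
      show "Im (h (complex_of_real x)) = 0" if "0 \<le> x" for x
        using v(2) tf_eval_real[of M x] unfolding h by (simp)
      show "Im (h (\<i> * complex_of_real w)) < 0" if "0 < w" for w
        unfolding h_def Im_quad_form by (rule class_Cs_dissipative[OF M that v(1)])
    qed
    then show ?thesis
      using inf unfolding pos_semidef_def h_def Re_quad_form by (metis le_less_trans)
  qed
  define a b where "a = (\<chi> i. complex_of_real (Re (x $ i)))" and "b = (\<chi> i. complex_of_real (Im (x $ i)))"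
  have im: "Im (tf_eval M 0 $ i $ j) = 0" for i j
    using tf_eval_real[of M 0] by simp
  have split: "x \<bullet> (tf_eval M 0 *v x) = a \<bullet> (tf_eval M 0 *v a) + b \<bullet> (tf_eval M 0 *v b)"
    using im by (simp add: a_def b_def inner_vec_def inner_complex_def matrix_vector_mult_def
        sum.distrib[symmetric] del: tf_eval_nth)
  have nonneg: "0 \<le> v \<bullet> (tf_eval M 0 *v v)" if "\<And>i. Im (v $ i) = 0" for v
    using real[of v] that by (cases "v = 0") (auto intro: less_imp_le)
  have "a \<noteq> 0 \<or> b \<noteq> 0"
    using \<open>x \<noteq> 0\<close> by (auto simp: a_def b_def vec_eq_iff complex_eq_iff)
  then show ?thesis
    unfolding split using real[of a] real[of b] nonneg[of a] nonneg[of b]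
    by (auto simp: a_def b_def intro: add_pos_nonneg add_nonneg_pos)
qed

section \<open>The loop determinant on the boundary of the right half plane\<close>

lemma tendsto_det:
  fixes F :: "'a \<Rightarrow> complex ^ 'n ^ 'n"
  assumes "(F \<longlongrightarrow> L) G"
  shows "((\<lambda>x. det (F x)) \<longlongrightarrow> det L) G"
  unfolding det_def by (intro tendsto_intros assms)

lemma tendsto_matrix_mult:
  fixes A B :: "'a \<Rightarrow> complex ^ 'n ^ 'n"
  assumes "(A \<longlongrightarrow> K) G" "(B \<longlongrightarrow> L) G"
  shows "((\<lambda>x. A x ** B x) \<longlongrightarrow> K ** L) G"
  unfolding matrix_matrix_mult_def
  by (intro vec_tendstoI) (simp add: tendsto_sum tendsto_mult tendsto_vec_nth assms)

lemma holomorphic_on_det: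
  fixes F :: "complex \<Rightarrow> complex ^ 'n ^ 'n"
  assumes "\<And>i j. (\<lambda>z. F z $ i $ j) holomorphic_on S"
  shows "(\<lambda>z. det (F z)) holomorphic_on S"
  unfolding det_def by (intro holomorphic_intros assms)

lemma det_cnj: "det (\<chi> i j. cnj (A $ i $ j)) = cnj (det A)"
  by (simp add: det_def)

lemma det_eq_0_imp_kernel:
  fixes A :: "complex ^ 'n ^ 'n"
  assumes "det A = 0"
  obtains x where "x \<noteq> 0" "A *v x = 0"
  using assms invertible_det_nz[of A] invertible_left_inverse[of A] matrix_left_invertible_ker[of A]
  by blast

text \<open>
  The matrix \<open>I - t D N\<close> for values \<open>D\<close> and \<open>N\<close> of \<open>\<Delta>\<close> and \<open>M\<close> at a point; the parameter \<open>t\<close> scales the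
  first system from \<open>0\<close> to \<open>\<Delta>\<close>.
\<close>

definition loop_matrix :: "real \<Rightarrow> complex ^ 'n ^ 'n \<Rightarrow> complex ^ 'n ^ 'n \<Rightarrow> complex ^ 'n ^ 'n" where
  "loop_matrix t D N = mat 1 - t *\<^sub>R (D ** N)"

lemma loop_matrix_singularE:
  assumes "det (loop_matrix t D N) = 0"
  obtains x where "x \<noteq> 0" "x = t *\<^sub>R (D *v (N *v x))"
proof -
  obtain x where x: "x \<noteq> 0" "loop_matrix t D N *v x = 0"
    using det_eq_0_imp_kernel[OF assms] .
  have "(t *\<^sub>R (D ** N)) *v x = t *\<^sub>R ((D ** N) *v x)"
    by (simp add: vec_eq_iff matrix_vector_mult_def scaleR_sum_right)
  then have "x = t *\<^sub>R (D *v (N *v x))"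
    using x(2) by (simp add: loop_matrix_def matrix_vector_mult_diff_rdistrib matrix_vector_mul_assoc)
  then show thesis using that x(1) by blast
qed

text \<open>
  If \<open>x = t \<Delta> y\<close> with \<open>y = M x\<close>, then \<open>Im (x\<^sup>* y) < 0\<close> by strictness of \<open>M\<close>, while
  \<open>Im (y\<^sup>* x) = t Im (y\<^sup>* \<Delta> y) \<le> 0\<close>; these two numbers have opposite signs.
\<close>

lemma loop_nonsingular_imag_axis:
  fixes \<Delta> M :: "ratfun ^ 'n ^ 'n"
  assumes "\<Delta> \<in> class_C" "M \<in> class_Cs" "0 < \<omega>" "0 \<le> t"
  defines "s \<equiv> \<i> * complex_of_real \<omega>"
  shows "det (loop_matrix t (tf_eval \<Delta> s) (tf_eval M s)) \<noteq> 0"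
proof
  assume "det (loop_matrix t (tf_eval \<Delta> s) (tf_eval M s)) = 0"
  then obtain x where x: "x \<noteq> 0" "x = t *\<^sub>R (tf_eval \<Delta> s *v (tf_eval M s *v x))"
    by (rule loop_matrix_singularE)
  define y where "y = tf_eval M s *v x"
  have "(\<i> *s x) \<bullet> y < 0"
    unfolding y_def s_def by (rule class_Cs_dissipative) (use assms x in auto)
  moreover have "(\<i> *s x) \<bullet> y = - ((\<i> *s y) \<bullet> x)"
    by (metis inner_i_left inner_commute)
  moreover have "(\<i> *s y) \<bullet> x = t * ((\<i> *s y) \<bullet> (tf_eval \<Delta> s *v y))"
    using x(2) unfolding y_def[symmetric] by (metis inner_scaleR_right)
  moreover have "t * ((\<i> *s y) \<bullet> (tf_eval \<Delta> s *v y)) \<le> 0"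
    unfolding s_def using class_C_dissipative[OF assms(1,3)] assms(4) by (rule mult_nonneg_nonpos[rotated])
  ultimately show False by linarith
qed

text \<open>
  With \<open>y = N x\<close> and \<open>q = x\<^sup>* N x > 0\<close>, a kernel vector would give
  \<open>q = t y\<^sup>* D y \<le> \<alpha> \<bar>y\<bar>\<^sup>2 \<le> \<alpha> \<beta> q < q\<close> for the maximum eigenvalues \<open>\<alpha>\<close> of \<open>D\<close> and \<open>\<beta>\<close> of \<open>N\<close>. The sign of \<open>\<alpha>\<close> is not
  restricted; \<open>\<alpha> \<le> 0\<close> contradicts \<open>q > 0\<close> directly.
\<close>

lemma loop_nonsingular_dc:
  fixes D N :: "complex ^ 'n ^ 'n"
  assumes D: "conj_transpose D = D" and N: "conj_transpose N = N"
    and pos: "\<And>x. x \<noteq> 0 \<Longrightarrow> 0 < x \<bullet> (N *v x)"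
    and gain: "max_eigenvalue D * max_eigenvalue N < 1" and t: "t \<in> {0..1}"
  shows "det (loop_matrix t D N) \<noteq> 0"
proof
  let ?\<alpha> = "max_eigenvalue D" and ?\<beta> = "max_eigenvalue N"
  assume "det (loop_matrix t D N) = 0"
  then obtain x where x: "x \<noteq> 0" "x = t *\<^sub>R (D *v (N *v x))"
    by (rule loop_matrix_singularE)
  define y where "y = N *v x"
  define q where "q = x \<bullet> y"
  have "0 < q" using pos[OF x(1)] by (simp add: q_def y_def)
  have "0 \<le> x \<bullet> (N *v x)" for x
    using pos[of x] by (cases "x = 0") auto
  then have yq: "y \<bullet> y \<le> ?\<beta> * q"
    unfolding y_def q_def by (rule psd_norm_bound[OF N])
  have "q = t * (y \<bullet> (D *v y))"
    using x(2) unfolding q_def y_def[symmetric] by (metis inner_scaleR_left inner_commute)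
  also have "\<dots> \<le> t * (?\<alpha> * (y \<bullet> y))"
    using t by (intro mult_left_mono Hermitian_max_eigenvalue D) auto
  finally have q: "q \<le> t * (?\<alpha> * (y \<bullet> y))" .
  show False
  proof (cases "?\<alpha> \<le> 0")
    case True
    then have "t * (?\<alpha> * (y \<bullet> y)) \<le> 0"
      using t by (simp add: mult_nonneg_nonpos mult_nonpos_nonneg)
    then show False using q \<open>0 < q\<close> by simp
  next
    case False
    have "t * (?\<alpha> * (y \<bullet> y)) \<le> 1 * (?\<alpha> * (y \<bullet> y))"
      using t False by (intro mult_right_mono) auto
    also have "\<dots> \<le> ?\<alpha> * (?\<beta> * q)"
      using yq False by simp
    also have "\<dots> = (?\<alpha> * ?\<beta>) * q" by simp
    also have "\<dots> < 1 * q"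
      using gain \<open>0 < q\<close> by (intro mult_strict_right_mono)
    finally show False using q by simp
  qed
qed

lemma loop_nonsingular_infinity:
  assumes "(D ** N) ** (D ** N) = (0 :: complex ^ 'n ^ 'n)"
  shows "det (loop_matrix t D N) \<noteq> 0"
proof
  define A where "A = D ** N"
  assume "det (loop_matrix t D N) = 0"
  then obtain x where x: "x \<noteq> 0" "x = t *\<^sub>R (D *v (N *v x))"
    by (rule loop_matrix_singularE)
  then have x_eq: "x = t *\<^sub>R (A *v x)"
    by (simp add: A_def matrix_vector_mul_assoc)
  then have "A *v x = A *v (t *\<^sub>R (A *v x))" by simp
  also have "\<dots> = t *\<^sub>R ((A ** A) *v x)"
    by (simp add: linear_scale[OF linear_complex_matrix] matrix_vector_mul_assoc)
  also have "\<dots> = 0" using assms by (simp add: A_def)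
  finally show False using x_eq x(1) by simp
qed

text \<open>
  The map \<open>z \<mapsto> (1 + z) / (1 - z)\<close> takes the closed unit disc to the closed right half plane together
  with infinity, which corresponds to \<open>z = 1\<close>.
\<close>

lemma Re_Moebius:
  assumes "z \<noteq> 1"
  shows "Re ((1 + z) / (1 - z)) = (1 - (norm z)\<^sup>2) / (norm (1 - z))\<^sup>2"
proof -
  have "(1 + z) / (1 - z) = (1 + z) * cnj (1 - z) / complex_of_real ((norm (1 - z))\<^sup>2)"
    by (rule complex_div_cnj)
  then have "Re ((1 + z) / (1 - z)) = Re ((1 + z) * cnj (1 - z)) / (norm (1 - z))\<^sup>2"
    by (simp only: Re_divide_of_real)
  also have "Re ((1 + z) * cnj (1 - z)) = 1 - (norm z)\<^sup>2"
    unfolding cmod_power2 by (simp add: algebra_simps power2_eq_square)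
  finally show ?thesis .
qed

lemma continuous_on_Moebius:
  fixes G :: "complex \<Rightarrow> 'a :: topological_space"
  assumes cont: "continuous_on {s. 0 \<le> Re s} G" and lim: "(G \<longlongrightarrow> L) at_infinity"
  shows "continuous_on (cball 0 1) (\<lambda>z. if z = 1 then L else G ((1 + z) / (1 - z)))"
proof -
  let ?K = "\<lambda>z. if z = 1 then L else G ((1 + z) / (1 - z))"
  have Re: "0 \<le> Re ((1 + z) / (1 - z))" if "z \<in> cball 0 1" "z \<noteq> 1" for z :: complex
    using that by (simp add: Re_Moebius abs_square_le_1)
  show ?thesis
    unfolding continuous_on_def
  proof
    fix z :: complex assume z: "z \<in> cball 0 1"
    show "(?K \<longlongrightarrow> ?K z) (at z within cball 0 1)"
    proof (cases "z = 1")
      case True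
      have "filterlim (\<lambda>z::complex. 1 - z) (at 0) (at 1)"
        by (rule filterlim_atI) (auto intro!: tendsto_eq_intros simp: eventually_at_filter)
      then have "filterlim (\<lambda>z::complex. (1 + z) / (1 - z)) at_infinity (at 1)"
        by (intro filterlim_divide_at_infinity[where c = 2]) (auto intro!: tendsto_eq_intros)
      then have "((\<lambda>z. G ((1 + z) / (1 - z))) \<longlongrightarrow> L) (at 1)"
        by (rule filterlim_compose[OF lim])
      then have "((\<lambda>z. G ((1 + z) / (1 - z))) \<longlongrightarrow> L) (at 1 within cball 0 1)"
        by (rule tendsto_within_subset) auto
      then have "(?K \<longlongrightarrow> L) (at 1 within cball 0 1)"
        by (rule Lim_transform_eventually) (auto simp: eventually_at_filter)
      then show ?thesis using True by simp
    next
      case False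
      have "continuous_on (cball 0 1 - {1}) (\<lambda>z. G ((1 + z) / (1 - z)))"
        by (intro continuous_on_compose2[OF cont] continuous_intros) (use Re in auto)
      then have "((\<lambda>z. G ((1 + z) / (1 - z))) \<longlongrightarrow> G ((1 + z) / (1 - z))) (at z within cball 0 1 - {1})"
        using z False unfolding continuous_on_def by blast
      moreover have "at z within cball 0 1 - {1} = at z within cball 0 1"
        by (rule at_within_nhd[of z "- {1}"]) (use False in auto)
      ultimately have "((\<lambda>z. G ((1 + z) / (1 - z))) \<longlongrightarrow> G ((1 + z) / (1 - z))) (at z within cball 0 1)"
        by simp
      moreover have "\<forall>\<^sub>F w in at z within cball 0 1. G ((1 + w) / (1 - w)) = ?K w"
        unfolding eventually_at_topological
        by (intro exI[of _ "- {1}"]) (use False in auto)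
      ultimately have "(?K \<longlongrightarrow> G ((1 + z) / (1 - z))) (at z within cball 0 1)"
        by (rule Lim_transform_eventually)
      then show ?thesis using False by simp
    qed
  qed
qed

text \<open>
  Points of the lower imaginary axis are reduced to the upper one by complex conjugation.
\<close>

lemma loop_nonsingular_boundary:
  fixes \<Delta> M :: "ratfun ^ 'n ^ 'n"
  assumes \<Delta>: "\<Delta> \<in> class_C" and M: "M \<in> class_Cs" and inf: "pos_semidef (tf_at_infinity M)"
    and gain: "max_eigenvalue (tf_eval \<Delta> 0) * max_eigenvalue (tf_eval M 0) < 1"
    and t: "t \<in> {0..1}" and s: "Re s = 0"
  shows "det (loop_matrix t (tf_eval \<Delta> s) (tf_eval M s)) \<noteq> 0"
proof -
  have s_eq: "s = \<i> * complex_of_real (Im s)" using s by (simp add: complex_eq_iff)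
  consider "Im s = 0" | "0 < Im s" | "Im s < 0" by linarith
  then show ?thesis
  proof cases
    case 1
    then have "s = 0" using s by (simp add: complex_eq_iff)
    have "M \<in> class_C" using M class_Cs_subset by blast
    then show ?thesis
      unfolding \<open>s = 0\<close> using class_Cs_dc_pos[OF M inf] gain t
      by (intro loop_nonsingular_dc class_C_dc_Hermitian \<Delta>)
  next
    case 2
    then show ?thesis
      using loop_nonsingular_imag_axis[OF \<Delta> M 2, of t] t s_eq by simp
  next
    case 3
    have cnj_s: "cnj s = \<i> * complex_of_real (- Im s)"
      using s by (simp add: complex_eq_iff)
    have "loop_matrix t (tf_eval \<Delta> (cnj s)) (tf_eval M (cnj s)) =
        (\<chi> i j. cnj (loop_matrix t (tf_eval \<Delta> s) (tf_eval M s) $ i $ j))"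
      by (simp add: vec_eq_iff loop_matrix_def mat_def matrix_matrix_mult_def tf_eval_cnj del: tf_eval_nth)
    moreover have "det (loop_matrix t (tf_eval \<Delta> (cnj s)) (tf_eval M (cnj s))) \<noteq> 0"
      unfolding cnj_s using loop_nonsingular_imag_axis[OF \<Delta> M, of "- Im s" t] 3 t by simp
    ultimately show ?thesis by (simp add: det_cnj)
  qed
qed

section \<open>Stability of the loop\<close>

text \<open>
  The homotopy \<open>t \<mapsto> I - t \<Delta> M\<close> starts at the identity and stays nonsingular on the imaginary axis and at
  infinity, so no zero of the determinant can enter the right half plane.
\<close>

lemma loop_nonsingular:
  fixes \<Delta> M :: "ratfun ^ 'n ^ 'n"
  assumes \<Delta>: "\<Delta> \<in> class_C" and M: "M \<in> class_Cs" and inf: "pos_semidef (tf_at_infinity M)"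
    and gain: "max_eigenvalue (tf_eval \<Delta> 0) * max_eigenvalue (tf_eval M 0) < 1"
    and nil: "(tf_at_infinity \<Delta> ** tf_at_infinity M) ** (tf_at_infinity \<Delta> ** tf_at_infinity M) = 0"
    and s: "0 \<le> Re s"
  shows "det (loop_matrix 1 (tf_eval \<Delta> s) (tf_eval M s)) \<noteq> 0"
proof -
  have RH: "\<Delta> \<in> RH_inf" "M \<in> RH_inf"
    using \<Delta> M by (simp_all add: class_C_def class_Cs_def)
  define H where "H s = tf_eval \<Delta> s ** tf_eval M s" for s
  define L where "L = tf_at_infinity \<Delta> ** tf_at_infinity M"
  define K where "K z = (if z = 1 then L else H ((1 + z) / (1 - z)))" for z
  define f where "f t z = det (mat 1 - t *\<^sub>R K z)" for t z
  have contH: "continuous_on {s. 0 \<le> Re s} H"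
    using tf_eval_continuous[OF RH(1)] tf_eval_continuous[OF RH(2)]
    unfolding H_def continuous_on_def by (auto intro: tendsto_matrix_mult)
  have limH: "(H \<longlongrightarrow> L) at_infinity"
    unfolding H_def L_def by (intro tendsto_matrix_mult tf_eval_tendsto RH)
  have contK: "continuous_on (cball 0 1) K"
    unfolding K_def by (rule continuous_on_Moebius[OF contH limH])
  have Re: "Re ((1 + z) / (1 - z)) = (1 - (norm z)\<^sup>2) / (norm (1 - z))\<^sup>2" if "z \<noteq> 1" for z :: complex
    using Re_Moebius[OF that] .
  have "f t z \<noteq> 0" if "t \<in> {0..1}" "z \<in> cball 0 1" for t z
  proof (rule zero_free_homotopy[OF _ _ _ _ that])
    have "continuous_on ({0..1} \<times> cball 0 1) (\<lambda>p. mat 1 - fst p *\<^sub>R K (snd p))"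
      by (intro continuous_intros continuous_on_compose2[OF contK]) auto
    then have "continuous_on ({0..1} \<times> cball 0 1) (\<lambda>p. det (mat 1 - fst p *\<^sub>R K (snd p)))"
      unfolding continuous_on_def by (auto intro: tendsto_det)
    then show "continuous_on ({0..1} \<times> cball 0 1) (\<lambda>(t, z). f t z)"
      by (simp add: f_def case_prod_beta)
  next
    fix t :: real assume "t \<in> {0..1}"
    have ne: "1 - z \<noteq> 0" and pos: "0 < Re ((1 + z) / (1 - z))" if "z \<in> ball 0 1" for z :: complex
    proof -
      have "z \<noteq> 1" using that by auto
      then show "1 - z \<noteq> 0" by simp
      show "0 < Re ((1 + z) / (1 - z))"
        unfolding Re[OF \<open>z \<noteq> 1\<close>] using that \<open>z \<noteq> 1\<close>
        by (intro divide_pos_pos) (simp_all add: abs_square_less_1)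
    qed
    have entry: "(\<lambda>z. tf_eval R ((1 + z) / (1 - z)) $ i $ j) holomorphic_on ball 0 1"
      if "R \<in> RH_inf" for R :: "ratfun ^ 'n ^ 'n" and i j
    proof -
      have "ratfun_eval (R $ i $ j) holomorphic_on {s. 0 < Re s}"
        using that by (simp only: RH_inf_iff stable_ratfun_holomorphic(1))
      moreover have "(\<lambda>z. (1 + z) / (1 - z)) holomorphic_on ball 0 1"
        by (intro holomorphic_intros ne)
      ultimately have "(ratfun_eval (R $ i $ j) \<circ> (\<lambda>z. (1 + z) / (1 - z))) holomorphic_on ball 0 1"
        using pos by (intro holomorphic_on_compose_gen[where t = "{s. 0 < Re s}"]) auto
      then show ?thesis by (simp add: o_def)
    qed
    have "(\<lambda>z. det (mat 1 - t *\<^sub>R H ((1 + z) / (1 - z)))) holomorphic_on ball 0 1"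
    proof (rule holomorphic_on_det)
      fix i j
      have "(\<lambda>z. mat 1 $ i $ j - t *\<^sub>R (\<Sum>k\<in>UNIV. tf_eval \<Delta> ((1 + z) / (1 - z)) $ i $ k *
          tf_eval M ((1 + z) / (1 - z)) $ k $ j)) holomorphic_on ball 0 1"
        by (intro holomorphic_intros entry RH)
      then show "(\<lambda>z. (mat 1 - t *\<^sub>R H ((1 + z) / (1 - z))) $ i $ j) holomorphic_on ball 0 1"
        by (simp add: H_def matrix_matrix_mult_def del: tf_eval_nth)
    qed
    then show "f t holomorphic_on ball 0 1"
      by (rule holomorphic_transform) (auto simp: f_def K_def)
  next
    fix t :: real and z :: complex assume t: "t \<in> {0..1}" and z: "z \<in> sphere 0 1"
    show "f t z \<noteq> 0"
    proof (cases "z = 1")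
      case True
      then show ?thesis
        using loop_nonsingular_infinity[OF nil, of t] by (simp add: f_def K_def L_def loop_matrix_def)
    next
      case False
      then have "Re ((1 + z) / (1 - z)) = 0" using Re z by simp
      from loop_nonsingular_boundary[OF \<Delta> M inf gain t this] False
      show ?thesis by (simp add: f_def K_def H_def loop_matrix_def)
    qed
  qed (simp add: f_def)
  note f = this
  define z where "z = (s - 1) / (s + 1)"
  have s1: "s + 1 \<noteq> 0" using s by (auto simp: complex_eq_iff)
  have "norm (s - 1) \<le> norm (s + 1)"
  proof (rule power2_le_imp_le)
    show "(norm (s - 1))\<^sup>2 \<le> (norm (s + 1))\<^sup>2"
      unfolding cmod_power2 using s by (simp add: power2_eq_square algebra_simps)
  qed simp
  then have "z \<in> cball 0 1"
    using s1 by (simp add: z_def norm_divide divide_le_eq)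
  moreover have "z \<noteq> 1" using s1 by (simp add: z_def)
  moreover have "(1 + z) / (1 - z) = s"
  proof -
    have "1 + z = 2 * s / (s + 1)" "1 - z = 2 / (s + 1)"
      using s1 by (simp_all add: z_def field_simps)
    then show ?thesis using s1 by simp
  qed
  ultimately show ?thesis
    using f[of 1 z] by (simp add: f_def K_def H_def loop_matrix_def)
qed

text \<open>
  By Cramer's rule the inverse of \<open>I - \<Delta> M\<close> over the rational functions is stable and proper as soon as the
  inverse of its determinant is; all four loop transfer matrices are built from it.
\<close>

lemma internally_stableI:
  fixes \<Delta> M :: "ratfun ^ 'n ^ 'n"
  assumes RH: "\<Delta> \<in> RH_inf" "M \<in> RH_inf"
    and nz: "\<And>s. 0 \<le> Re s \<Longrightarrow> det (loop_matrix 1 (tf_eval \<Delta> s) (tf_eval M s)) \<noteq> 0"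
    and nz_inf: "det (loop_matrix 1 (tf_at_infinity \<Delta>) (tf_at_infinity M)) \<noteq> 0"
  shows "internally_stable \<Delta> M"
proof -
  define A where "A = mat 1 - \<Delta> ** M"
  have A: "A \<in> RH_inf"
    unfolding A_def by (intro RH_inf_diff RH_inf_mat_1 RH_inf_mult RH)
  have det_eval: "ratfun_eval (det A) s = det (loop_matrix 1 (tf_eval \<Delta> s) (tf_eval M s))"
    if "0 \<le> Re s" for s
  proof -
    have "tf_eval A s = loop_matrix 1 (tf_eval \<Delta> s) (tf_eval M s)"
      unfolding A_def loop_matrix_def
      by (simp only: RH_inf_diff(2)[OF RH_inf_mat_1 RH_inf_mult(1)[OF RH] that] tf_eval_mat_1
          RH_inf_mult(2)[OF RH that] scaleR_one)
    then show ?thesis by (simp only: stable_ratfun_det(2)[OF A that])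
  qed
  obtain l where l: "(ratfun_eval (det A) \<longlongrightarrow> l) at_infinity"
    using stable_ratfun_tendsto[OF stable_ratfun_det(1)[OF A]] ..
  \<comment> \<open>Evaluation is known to be multiplicative only on the closed right half plane, so the limit is
    identified along the positive real axis.\<close>
  have "((\<lambda>x. ratfun_eval (det A) (complex_of_real x)) \<longlongrightarrow> l) at_top"
    by (rule filterlim_compose[OF l filterlim_of_real_at_infinity])
  moreover have "((\<lambda>x. ratfun_eval (det A) (complex_of_real x)) \<longlongrightarrow>
      det (loop_matrix 1 (tf_at_infinity \<Delta>) (tf_at_infinity M))) at_top"
  proof (rule Lim_transform_eventually)
    show "((\<lambda>x. det (loop_matrix 1 (tf_eval \<Delta> (complex_of_real x)) (tf_eval M (complex_of_real x)))) \<longlongrightarrow>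
        det (loop_matrix 1 (tf_at_infinity \<Delta>) (tf_at_infinity M))) at_top"
      unfolding loop_matrix_def
      by (intro tendsto_det tendsto_intros tendsto_matrix_mult
          filterlim_compose[OF tf_eval_tendsto filterlim_of_real_at_infinity] RH)
    show "\<forall>\<^sub>F x in at_top. det (loop_matrix 1 (tf_eval \<Delta> (complex_of_real x)) (tf_eval M (complex_of_real x))) =
        ratfun_eval (det A) (complex_of_real x)"
      using eventually_ge_at_top[of 0] by eventually_elim (simp only: det_eval Re_complex_of_real)
  qed
  ultimately have "l = det (loop_matrix 1 (tf_at_infinity \<Delta>) (tf_at_infinity M))"
    by (rule tendsto_unique[rotated 1]) simp
  then have "l \<noteq> 0" using nz_inf by simp
  have inv: "inverse (det A) \<in> stable_ratfun"
    by (rule stable_ratfun_inverse[OF stable_ratfun_det(1)[OF A] l \<open>l \<noteq> 0\<close>])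
      (simp only: det_eval nz not_False_eq_True)
  have det_A: "det A \<noteq> 0"
    using det_eval[of 0] nz[of 0] ratfun_eval_0[of 0] by auto
  define C where "C k l = (\<chi> i j. if j = k then axis l 1 $ i else A $ i $ j)" for k l
  have C: "C k l \<in> RH_inf" for k l
    using A stable_ratfun_0 stable_ratfun_1 unfolding C_def RH_inf_iff axis_def vec_lambda_beta
    by (simp split: if_split)
  define X where "X = (\<chi> k l. det (C k l) * inverse (det A))"
  have X: "X \<in> RH_inf"
    unfolding RH_inf_iff X_def vec_lambda_beta by (intro allI stable_ratfun_mult stable_ratfun_det(1) C inv)
  have AX: "A ** X = mat 1"
  proof -
    have "A *v (\<chi> k. X $ k $ l) = axis l 1" for l
      unfolding cramer[OF det_A] X_def C_def vec_lambda_beta divide_inverse ..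
    then have "(A *v (\<chi> k. X $ k $ l)) $ i = axis l 1 $ i" for i l by simp
    then have "(A ** X) $ i $ l = mat 1 $ i $ l" for i l
      unfolding matrix_matrix_mult_def matrix_vector_mult_def vec_lambda_beta
      by (simp only: axis_def mat_def vec_lambda_beta)
    then show ?thesis by (simp only: vec_eq_iff simp_thms)
  qed
  then have XA: "X ** A = mat 1" by (simp only: matrix_left_right_inverse)
  have "loop_transfer \<Delta> M (mat 1 + M ** (X ** \<Delta>)) (M ** X) (X ** \<Delta>) X"
    unfolding loop_transfer_def
  proof (intro allI iffI)
    fix w1 w2 e1 e2 :: "ratfun ^ 'n"
    have Av: "A *v e = e - \<Delta> *v (M *v e)" for e
      by (simp only: A_def matrix_vector_mult_diff_rdistrib matrix_vector_mul_lid matrix_vector_mul_assoc)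
    have G11: "(mat 1 + M ** (X ** \<Delta>)) *v w1 + M ** X *v w2 = w1 + M *v (X *v (w2 + \<Delta> *v w1))"
      by (simp only: matrix_vector_mult_add_rdistrib matrix_vector_mul_lid matrix_vector_mul_assoc[symmetric]
          matrix_vector_right_distrib add.assoc add.left_commute add.commute)
    have G21: "(X ** \<Delta>) *v w1 + X *v w2 = X *v (w2 + \<Delta> *v w1)"
      by (simp only: matrix_vector_mul_assoc[symmetric] matrix_vector_right_distrib add.commute)
    {
      assume e: "e1 = w1 + M *v e2 \<and> e2 = w2 + \<Delta> *v e1"
      then have "e2 = w2 + (\<Delta> *v w1 + \<Delta> *v (M *v e2))"
        by (metis matrix_vector_right_distrib)
      then have "A *v e2 = w2 + \<Delta> *v w1"
        unfolding Av by (simp only: diff_eq_eq add.assoc)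
      then have Xe: "X *v (w2 + \<Delta> *v w1) = e2"
        by (metis XA matrix_vector_mul_assoc matrix_vector_mul_lid)
      show "e1 = (mat 1 + M ** (X ** \<Delta>)) *v w1 + M ** X *v w2 \<and> e2 = (X ** \<Delta>) *v w1 + X *v w2"
        unfolding G11 G21 Xe using e by blast
    next
      assume "e1 = (mat 1 + M ** (X ** \<Delta>)) *v w1 + M ** X *v w2 \<and> e2 = (X ** \<Delta>) *v w1 + X *v w2"
      then have e: "e2 = X *v (w2 + \<Delta> *v w1)" "e1 = w1 + M *v e2"
        unfolding G11 G21 by blast+
      have "A *v e2 = w2 + \<Delta> *v w1"
        unfolding e(1) by (simp only: matrix_vector_mul_assoc AX matrix_vector_mul_lid)
      then have "e2 = w2 + \<Delta> *v w1 + \<Delta> *v (M *v e2)"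
        unfolding Av by (simp only: diff_eq_eq)
      then show "e1 = w1 + M *v e2 \<and> e2 = w2 + \<Delta> *v e1"
        using e(2) by (metis matrix_vector_right_distrib add.assoc)
    }
  qed
  moreover have "mat 1 + M ** (X ** \<Delta>) \<in> RH_inf" "M ** X \<in> RH_inf" "X ** \<Delta> \<in> RH_inf"
    by (intro RH_inf_add RH_inf_mat_1 RH_inf_mult RH X)+
  moreover have "well_posed \<Delta> M"
    using nz_inf by (simp add: well_posed_def invertible_det_nz loop_matrix_def)
  ultimately show ?thesis
    unfolding internally_stable_def using X by blast
qed

lemma internally_stable_swap:
  assumes "internally_stable \<Delta> M"
  shows "internally_stable M \<Delta>"
proof -
  let ?P = "tf_at_infinity \<Delta>" and ?Q = "tf_at_infinity M"
  obtain B where B: "B ** (mat 1 - ?P ** ?Q) = mat 1"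
    using assms invertible_left_inverse unfolding internally_stable_def well_posed_def by blast
  have "det (loop_matrix 1 ?Q ?P) \<noteq> 0"
  proof
    assume "det (loop_matrix 1 ?Q ?P) = 0"
    then obtain x where x: "x \<noteq> 0" "x = 1 *\<^sub>R (?Q *v (?P *v x))"
      by (rule loop_matrix_singularE)
    then have "?P *v (?Q *v (?P *v x)) = ?P *v x" by simp
    then have "(mat 1 - ?P ** ?Q) *v (?P *v x) = 0"
      by (simp add: matrix_vector_mult_diff_rdistrib flip: matrix_vector_mul_assoc)
    then have "?P *v x = 0"
      by (metis B matrix_vector_mul_assoc matrix_vector_mul_lid matrix_vector_mult_0_right)
    then show False using x by simp
  qed
  then have "well_posed M \<Delta>"
    by (simp add: well_posed_def invertible_det_nz loop_matrix_def)
  moreover have "loop_transfer M \<Delta> G22 G21 G12 G11" if "loop_transfer \<Delta> M G11 G12 G21 G22" for G11 G12 G21 G22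
    unfolding loop_transfer_def
  proof (intro allI)
    fix w1 w2 e1 e2
    show "(e1 = w1 + \<Delta> *v e2 \<and> e2 = w2 + M *v e1) =
       (e1 = G22 *v w1 + G21 *v w2 \<and> e2 = G12 *v w1 + G11 *v w2)"
      using that[unfolded loop_transfer_def, rule_format, of e2 w2 e1 w1]
      by (simp only: conj_commute add.commute)
  qed
  ultimately show ?thesis
    using assms unfolding internally_stable_def by blast
qed

text \<open>
  The transfer matrix from \<open>w2\<close> to \<open>e2\<close> is an inverse of \<open>I - \<Delta> M\<close> in \<^const>\<open>RH_inf\<close>, and the identity
  \<open>(I - \<Delta> M) G = I\<close> can be evaluated in the closed right half plane.
\<close>

lemma internally_stable_imp_nonsingular:
  fixes \<Delta> M :: "ratfun ^ 'n ^ 'n"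
  assumes "internally_stable \<Delta> M" and RH: "\<Delta> \<in> RH_inf" "M \<in> RH_inf" and s: "0 \<le> Re s"
  shows "det (loop_matrix 1 (tf_eval \<Delta> s) (tf_eval M s)) \<noteq> 0"
proof -
  obtain G11 G12 G21 G22 where "G22 \<in> RH_inf" and loop: "loop_transfer \<Delta> M G11 G12 G21 G22"
    using assms(1) unfolding internally_stable_def by blast
  define A where "A = mat 1 - \<Delta> ** M"
  have A: "A \<in> RH_inf"
    unfolding A_def by (intro RH_inf_diff RH_inf_mat_1 RH_inf_mult RH)
  have "(A ** G22) *v w = mat 1 *v w" for w
  proof -
    have "G12 *v w = G11 *v 0 + G12 *v w \<and> G22 *v w = G21 *v 0 + G22 *v w"
      by (simp only: matrix_vector_mult_0_right add_0_left simp_thms)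
    then have eq: "G12 *v w = 0 + M *v (G22 *v w) \<and> G22 *v w = w + \<Delta> *v (G12 *v w)"
      by (rule loop[unfolded loop_transfer_def, rule_format, THEN iffD2])
    have "G12 *v w = M *v (G22 *v w)"
      using conjunct1[OF eq] by (rule trans) (rule add_0_left)
    then have "G22 *v w = w + \<Delta> *v (M *v (G22 *v w))"
      using conjunct2[OF eq] by (simp only:)
    then show ?thesis
      unfolding A_def
      by (simp only: matrix_vector_mul_assoc[symmetric] matrix_vector_mult_diff_rdistrib
          matrix_vector_mul_lid diff_eq_eq)
  qed
  then have "A ** G22 = mat 1"
    using matrix_eq by blast
  then have "tf_eval A s ** tf_eval G22 s = mat 1"
    by (metis RH_inf_mult(2)[OF A \<open>G22 \<in> RH_inf\<close> s] tf_eval_mat_1)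
  then have "det (tf_eval A s) * det (tf_eval G22 s) = 1"
    by (metis det_mul det_I)
  moreover have "tf_eval A s = loop_matrix 1 (tf_eval \<Delta> s) (tf_eval M s)"
    unfolding A_def loop_matrix_def
    by (simp only: RH_inf_diff(2)[OF RH_inf_mat_1 RH_inf_mult(1)[OF RH] s] tf_eval_mat_1
        RH_inf_mult(2)[OF RH s] scaleR_one)
  ultimately show ?thesis by auto
qed

lemma internally_stable_small_gain:
  fixes \<Delta> M :: "ratfun ^ 'n ^ 'n"
  assumes "\<Delta> \<in> class_C" "M \<in> class_Cs" "pos_semidef (tf_at_infinity M)"
    and "max_eigenvalue (tf_eval \<Delta> 0) * max_eigenvalue (tf_eval M 0) < 1"
    and nil: "(tf_at_infinity \<Delta> ** tf_at_infinity M) ** (tf_at_infinity \<Delta> ** tf_at_infinity M) = 0"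
  shows "internally_stable \<Delta> M"
proof (rule internally_stableI)
  show "\<Delta> \<in> RH_inf" "M \<in> RH_inf"
    using assms by (simp_all add: class_C_def class_Cs_def)
  show "det (loop_matrix 1 (tf_eval \<Delta> s) (tf_eval M s)) \<noteq> 0" if "0 \<le> Re s" for s
    using loop_nonsingular[OF assms that] .
  show "det (loop_matrix 1 (tf_at_infinity \<Delta>) (tf_at_infinity M)) \<noteq> 0"
    by (rule loop_nonsingular_infinity[OF nil])
qed

lemma class_Cs_max_eigenvalue_pos:
  fixes M :: "ratfun ^ 'n ^ 'n"
  assumes "M \<in> class_Cs" "pos_semidef (tf_at_infinity M)"
  shows "0 < max_eigenvalue (tf_eval M 0)"
proof -
  have "conj_transpose (tf_eval M 0) = tf_eval M 0"
    using assms(1) class_Cs_subset class_C_dc_Hermitian by blast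
  then obtain v where v: "v \<noteq> 0" "tf_eval M 0 *v v = max_eigenvalue (tf_eval M 0) *\<^sub>R v"
    using Hermitian_max_eigenvalue(2) by blast
  then have "0 < max_eigenvalue (tf_eval M 0) * (v \<bullet> v)"
    using class_Cs_dc_pos[OF assms v(1)] by simp
  moreover have "0 < v \<bullet> v" using v(1) by simp
  ultimately show ?thesis by (rule zero_less_mult_pos2)
qed

section \<open>A destabilizing first-order lag\<close>

text \<open>
  The transfer matrix \<open>c / (s + 1) I\<close>.
\<close>

definition scalar_lag :: "real \<Rightarrow> ratfun ^ 'n ^ 'n" where
  "scalar_lag c = (\<chi> i j. if i = j then Fract [:c:] [:1, 1:] else 0)"

lemma Fract_lag:
  shows "Fract [:c:] [:1, 1:] \<in> stable_ratfun"
    and "0 \<le> Re s \<Longrightarrow> ratfun_eval (Fract [:c:] [:1, 1:]) s = complex_of_real c / (1 + s)"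
proof -
  have nz: "poly (cpoly [:1, 1:]) s \<noteq> 0" if "0 \<le> Re s" for s
    using that by (auto simp: map_poly_pCons complex_eq_iff)
  show "Fract [:c:] [:1, 1:] \<in> stable_ratfun"
    by (rule stable_ratfun_FractI) (use nz in auto)
  show "0 \<le> Re s \<Longrightarrow> ratfun_eval (Fract [:c:] [:1, 1:]) s = complex_of_real c / (1 + s)"
    by (subst ratfun_eval_Fract(2)[OF nz]) (simp_all add: map_poly_pCons)
qed

lemma tf_eval_scalar_lag:
  assumes "0 \<le> Re s"
  shows "tf_eval (scalar_lag c) s = mat (complex_of_real c / (1 + s))"
  unfolding vec_eq_iff tf_eval_nth scalar_lag_def mat_def vec_lambda_beta
  using Fract_lag(2)[OF assms, of c] ratfun_eval_0[of s] by simp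

lemma scalar_lag_RH_inf: "scalar_lag c \<in> RH_inf"
  unfolding RH_inf_iff scalar_lag_def vec_lambda_beta
  using Fract_lag(1) stable_ratfun_0 by simp

lemma mat_mult_vec: "mat k *v x = k *s x"
  by (simp add: vec_eq_iff matrix_vector_mult_def mat_def if_distrib[of "\<lambda>a. a * _"] cong: if_cong)

lemma scalar_lag_class_Cs:
  assumes "0 < c"
  shows "(scalar_lag c :: ratfun ^ 'n ^ 'n) \<in> class_Cs"
  unfolding class_Cs_def
proof (intro CollectI conjI allI impI scalar_lag_RH_inf)
  fix \<omega> :: real assume "0 < \<omega>"
  let ?k = "complex_of_real c / (1 + \<i> * complex_of_real \<omega>)"
  have form: "imag_axis_form (scalar_lag c) \<omega> = skew_part (mat ?k)"
    by (simp add: imag_axis_form_eq tf_eval_scalar_lag)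
  have Im_k: "Im ?k = - (c * \<omega> / (1 + \<omega>\<^sup>2))"
    by (simp add: Im_divide)
  have "0 < x \<bullet> (skew_part (mat ?k) *v x)" if "x \<noteq> 0" for x :: "complex ^ 'n"
  proof -
    have "(\<i> *s x) \<bullet> (mat ?k *v x) = Im ?k * (x \<bullet> x)"
      unfolding mat_mult_vec by (rule inner_i_scalar_mult)
    also have "\<dots> < 0"
      unfolding Im_k using assms \<open>0 < \<omega>\<close> that
      by (intro mult_neg_pos) (simp_all add: add_pos_nonneg)
    finally show ?thesis by (simp add: inner_skew_part)
  qed
  then show "pos_def (imag_axis_form (scalar_lag c :: ratfun ^ 'n ^ 'n) \<omega>)"
    by (simp add: pos_def_def form conj_transpose_skew_part Re_quad_form)
qed

lemma tf_at_infinity_scalar_lag: "tf_at_infinity (scalar_lag c :: ratfun ^ 'n ^ 'n) = 0"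
proof -
  let ?R = "scalar_lag c :: ratfun ^ 'n ^ 'n"
  have "((\<lambda>x. tf_eval ?R (complex_of_real x)) \<longlongrightarrow> tf_at_infinity ?R) at_top"
    by (rule filterlim_compose[OF tf_eval_tendsto[OF scalar_lag_RH_inf] filterlim_of_real_at_infinity])
  moreover have "((\<lambda>x. tf_eval ?R (complex_of_real x)) \<longlongrightarrow> 0) at_top"
  proof (rule Lim_transform_eventually)
    have "((\<lambda>x. complex_of_real (c / (1 + x))) \<longlongrightarrow> complex_of_real 0) at_top"
      by (intro tendsto_of_real real_tendsto_divide_at_top[where c = c] tendsto_const
          filterlim_tendsto_add_at_top[OF tendsto_const] filterlim_ident)
    then show "((\<lambda>x. mat (complex_of_real c / (1 + complex_of_real x)) :: complex ^ 'n ^ 'n) \<longlongrightarrow> 0) at_top"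
    proof (intro vec_tendstoI)
      fix i j :: 'n
      assume "((\<lambda>x. complex_of_real (c / (1 + x))) \<longlongrightarrow> complex_of_real 0) at_top"
      then show "((\<lambda>x. (mat (complex_of_real c / (1 + complex_of_real x)) :: complex ^ 'n ^ 'n) $ i $ j) \<longlongrightarrow>
          0 $ i $ j) at_top"
        by (cases "i = j") (simp_all add: mat_def)
    qed
    show "\<forall>\<^sub>F x in at_top. mat (complex_of_real c / (1 + complex_of_real x)) =
        tf_eval ?R (complex_of_real x)"
      using eventually_ge_at_top[of 0] by eventually_elim (simp add: tf_eval_scalar_lag)
  qed
  ultimately show ?thesis
    by (rule tendsto_unique[rotated 1]) simp
qed

text \<open>
  For an eigenvector \<open>v\<close> of \<open>M(0)\<close> with the maximum eigenvalue \<open>\<mu>\<close>, \<open>\<Delta>(0) M(0) v = v\<close>, so the closed loop has a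
  pole at \<open>0\<close>.
\<close>

lemma destabilizing_lag:
  fixes M :: "ratfun ^ 'n ^ 'n"
  assumes M: "M \<in> class_C" and pos: "0 < max_eigenvalue (tf_eval M 0)"
  defines "\<Delta> \<equiv> scalar_lag (1 / max_eigenvalue (tf_eval M 0)) :: ratfun ^ 'n ^ 'n"
  shows "\<Delta> \<in> class_Cs" "tf_at_infinity \<Delta> = 0"
    "max_eigenvalue (tf_eval \<Delta> 0) = 1 / max_eigenvalue (tf_eval M 0)"
    "\<not> internally_stable \<Delta> M"
proof -
  define \<mu> where "\<mu> = max_eigenvalue (tf_eval M 0)"
  have "0 < \<mu>" using pos by (simp add: \<mu>_def)
  show Cs: "\<Delta> \<in> class_Cs"
    unfolding \<Delta>_def using pos by (intro scalar_lag_class_Cs) simp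
  show "tf_at_infinity \<Delta> = 0"
    unfolding \<Delta>_def by (rule tf_at_infinity_scalar_lag)
  have dc: "tf_eval \<Delta> 0 = mat (complex_of_real (1 / \<mu>))"
    unfolding \<Delta>_def \<mu>_def by (subst tf_eval_scalar_lag) simp_all
  have "conj_transpose (tf_eval \<Delta> 0) = tf_eval \<Delta> 0"
    using Cs class_Cs_subset class_C_dc_Hermitian by blast
  then obtain u where "u \<noteq> 0" "tf_eval \<Delta> 0 *v u = max_eigenvalue (tf_eval \<Delta> 0) *\<^sub>R u"
    using Hermitian_max_eigenvalue(2) by blast
  moreover have "tf_eval \<Delta> 0 *v u = (1 / \<mu>) *\<^sub>R u"
    unfolding dc mat_mult_vec by (rule of_real_vector_mult)
  ultimately show "max_eigenvalue (tf_eval \<Delta> 0) = 1 / max_eigenvalue (tf_eval M 0)"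
    unfolding \<mu>_def[symmetric] by (metis scaleR_cancel_right)
  obtain v where v: "v \<noteq> 0" "tf_eval M 0 *v v = \<mu> *\<^sub>R v"
    using Hermitian_max_eigenvalue(2)[OF class_C_dc_Hermitian[OF M]] unfolding \<mu>_def by blast
  have "tf_eval \<Delta> 0 *v (tf_eval M 0 *v v) = v"
    unfolding v(2) dc mat_mult_vec of_real_vector_mult using \<open>0 < \<mu>\<close> by simp
  then have "loop_matrix 1 (tf_eval \<Delta> 0) (tf_eval M 0) *v v = 0"
    by (simp add: loop_matrix_def matrix_vector_mult_diff_rdistrib flip: matrix_vector_mul_assoc)
  then have "det (loop_matrix 1 (tf_eval \<Delta> 0) (tf_eval M 0)) = 0"
    using v(1) invertible_det_nz invertible_left_inverse matrix_left_invertible_ker by metis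
  then show "\<not> internally_stable \<Delta> M"
    using internally_stable_imp_nonsingular[of \<Delta> M 0] Cs M
    by (auto simp: class_Cs_def class_C_def)
qed

section \<open>The sharp gain bounds\<close>

text \<open>
  The loop is considered in either order, but the product of the gains at infinity is known to be zero
  in one order only; the product in the other order still has square zero.
\<close>

lemma zero_product_imp_nilpotent:
  fixes A B :: "complex ^ 'n ^ 'n"
  assumes "A ** B = 0 \<or> B ** A = 0"
  shows "(A ** B) ** (A ** B) = 0"
proof -
  have "(A ** B) ** (A ** B) = A ** ((B ** A) ** B)"
    by (simp add: matrix_mul_assoc)
  moreover have "0 ** B = (0 :: complex ^ 'n ^ 'n)" "B ** 0 = (0 :: complex ^ 'n ^ 'n)" for B :: "complex ^ 'n ^ 'n"
    by (simp_all add: matrix_matrix_mult_def vec_eq_iff)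
  ultimately show ?thesis using assms by metis
qed

theorem corollary6:
  fixes \<gamma> :: real and M :: "ratfun ^ 'n ^ 'n"
  assumes "\<gamma> > 0"
  shows
    "(M \<in> class_Cs \<and> pos_semidef (tf_at_infinity M) \<longrightarrow>
        ((\<forall>\<Delta> \<in> class_C. tf_at_infinity \<Delta> ** tf_at_infinity M = 0 \<and>
              max_eigenvalue (tf_eval \<Delta> 0) < \<gamma> \<longrightarrow> internally_stable \<Delta> M)
          \<longleftrightarrow> max_eigenvalue (tf_eval M 0) \<le> 1 / \<gamma>) \<and>
        ((\<forall>\<Delta> \<in> class_C. tf_at_infinity \<Delta> ** tf_at_infinity M = 0 \<and>
              max_eigenvalue (tf_eval \<Delta> 0) \<le> \<gamma> \<longrightarrow> internally_stable \<Delta> M)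
          \<longleftrightarrow> max_eigenvalue (tf_eval M 0) < 1 / \<gamma>)) \<and>
     (M \<in> class_C \<longrightarrow>
        ((\<forall>\<Delta> \<in> class_Cs. pos_semidef (tf_at_infinity \<Delta>) \<and>
              tf_at_infinity \<Delta> ** tf_at_infinity M = 0 \<and>
              max_eigenvalue (tf_eval \<Delta> 0) < \<gamma> \<longrightarrow> internally_stable \<Delta> M)
          \<longleftrightarrow> max_eigenvalue (tf_eval M 0) \<le> 1 / \<gamma>) \<and>
        ((\<forall>\<Delta> \<in> class_Cs. pos_semidef (tf_at_infinity \<Delta>) \<and>
              tf_at_infinity \<Delta> ** tf_at_infinity M = 0 \<and>
              max_eigenvalue (tf_eval \<Delta> 0) \<le> \<gamma> \<longrightarrow> internally_stable \<Delta> M)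
          \<longleftrightarrow> max_eigenvalue (tf_eval M 0) < 1 / \<gamma>))"
proof -
  let ?\<mu> = "max_eigenvalue (tf_eval M 0)"
  have psd_0: "pos_semidef (0 :: complex ^ 'n ^ 'n)"
    by (simp add: pos_semidef_def Re_quad_form vec_eq_iff)
  have zero_mult: "0 ** B = (0 :: complex ^ 'n ^ 'n)" for B :: "complex ^ 'n ^ 'n"
    by (simp add: matrix_matrix_mult_def vec_eq_iff)
  have destabilizing: "\<exists>\<Delta> :: ratfun ^ 'n ^ 'n. \<Delta> \<in> class_Cs \<and> \<Delta> \<in> class_C \<and>
      pos_semidef (tf_at_infinity \<Delta>) \<and> tf_at_infinity \<Delta> ** tf_at_infinity M = 0 \<and>
      max_eigenvalue (tf_eval \<Delta> 0) = 1 / ?\<mu> \<and> \<not> internally_stable \<Delta> M"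
    if "M \<in> class_C" "0 < ?\<mu>"
  proof (intro exI conjI)
    note lag = destabilizing_lag[OF that]
    let ?\<Delta> = "scalar_lag (1 / ?\<mu>) :: ratfun ^ 'n ^ 'n"
    show "?\<Delta> \<in> class_C" using lag(1) class_Cs_subset by blast
    show "pos_semidef (tf_at_infinity ?\<Delta>)" "tf_at_infinity ?\<Delta> ** tf_at_infinity M = 0"
      unfolding lag(2) by (rule psd_0 zero_mult)+
  qed (fact destabilizing_lag[OF that])+
  have inv_less: "1 / ?\<mu> < \<gamma> \<and> 0 < ?\<mu>" if "\<not> ?\<mu> \<le> 1 / \<gamma>"
  proof -
    have "0 < ?\<mu>"
      using that assms divide_pos_pos[of 1 \<gamma>] by linarith
    then show ?thesis using that assms by (simp add: field_simps)
  qed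
  have inv_le: "1 / ?\<mu> \<le> \<gamma> \<and> 0 < ?\<mu>" if "\<not> ?\<mu> < 1 / \<gamma>"
  proof -
    have "0 < ?\<mu>"
      using that assms divide_pos_pos[of 1 \<gamma>] by linarith
    then show ?thesis using that assms by (simp add: field_simps)
  qed
  have product_less: "a * b < 1"
    if "0 < b" "a < \<gamma> \<and> b \<le> 1 / \<gamma> \<or> a \<le> \<gamma> \<and> b < 1 / \<gamma>" for a b
  proof -
    have "a < \<gamma> \<Longrightarrow> a * b < \<gamma> * b" "a \<le> \<gamma> \<Longrightarrow> a * b \<le> \<gamma> * b"
      using that(1) by simp_all
    moreover have "b \<le> 1 / \<gamma> \<Longrightarrow> \<gamma> * b \<le> 1" "b < 1 / \<gamma> \<Longrightarrow> \<gamma> * b < 1"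
      using assms by (simp_all add: field_simps)
    ultimately show ?thesis using that(2) by linarith
  qed
  have product_less_swapped: "b * a < 1"
    if "0 < a" "a < \<gamma> \<and> b \<le> 1 / \<gamma> \<or> a \<le> \<gamma> \<and> b < 1 / \<gamma>" for a b
  proof -
    have "b \<le> 1 / \<gamma> \<Longrightarrow> b * a \<le> 1 / \<gamma> * a" "b < 1 / \<gamma> \<Longrightarrow> b * a < 1 / \<gamma> * a"
      using that(1) by (simp_all only: mult_right_mono mult_strict_right_mono less_imp_le)
    moreover have "a < \<gamma> \<Longrightarrow> 1 / \<gamma> * a < 1" "a \<le> \<gamma> \<Longrightarrow> 1 / \<gamma> * a \<le> 1"
      using assms by (simp_all add: field_simps)
    ultimately show ?thesis using that(2) by linarith
  qed
  have stable_I: "internally_stable \<Delta> M"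
    if "M \<in> class_Cs" "pos_semidef (tf_at_infinity M)" "\<Delta> \<in> class_C"
      "tf_at_infinity \<Delta> ** tf_at_infinity M = 0"
      "max_eigenvalue (tf_eval \<Delta> 0) < \<gamma> \<and> ?\<mu> \<le> 1 / \<gamma> \<or> max_eigenvalue (tf_eval \<Delta> 0) \<le> \<gamma> \<and> ?\<mu> < 1 / \<gamma>"
    for \<Delta>
    using that by (intro internally_stable_small_gain product_less class_Cs_max_eigenvalue_pos
        zero_product_imp_nilpotent) auto
  \<comment> \<open>With \<open>M\<close> merely negative imaginary, the strict system is \<open>\<Delta>\<close>, so the two exchange their roles.\<close>
  have stable_II: "internally_stable \<Delta> M"
    if "M \<in> class_C" "\<Delta> \<in> class_Cs" "pos_semidef (tf_at_infinity \<Delta>)"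
      "tf_at_infinity \<Delta> ** tf_at_infinity M = 0"
      "max_eigenvalue (tf_eval \<Delta> 0) < \<gamma> \<and> ?\<mu> \<le> 1 / \<gamma> \<or> max_eigenvalue (tf_eval \<Delta> 0) \<le> \<gamma> \<and> ?\<mu> < 1 / \<gamma>"
    for \<Delta>
  proof (rule internally_stable_swap, rule internally_stable_small_gain)
    have "0 < max_eigenvalue (tf_eval \<Delta> 0)"
      using that by (intro class_Cs_max_eigenvalue_pos)
    then show "?\<mu> * max_eigenvalue (tf_eval \<Delta> 0) < 1"
      using product_less_swapped that(5) by blast
  qed (use that zero_product_imp_nilpotent in blast)+
  show ?thesis
  proof (intro conjI impI iffI ballI; (elim conjE)?)
    assume "M \<in> class_Cs" and stable: "\<forall>\<Delta> \<in> class_C. tf_at_infinity \<Delta> ** tf_at_infinity M = 0 \<and>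
              max_eigenvalue (tf_eval \<Delta> 0) < \<gamma> \<longrightarrow> internally_stable \<Delta> M"
    then have "M \<in> class_C" using class_Cs_subset by blast
    show "?\<mu> \<le> 1 / \<gamma>"
      using destabilizing[OF \<open>M \<in> class_C\<close>] inv_less stable by metis
  next
    assume "M \<in> class_Cs" and stable: "\<forall>\<Delta> \<in> class_C. tf_at_infinity \<Delta> ** tf_at_infinity M = 0 \<and>
              max_eigenvalue (tf_eval \<Delta> 0) \<le> \<gamma> \<longrightarrow> internally_stable \<Delta> M"
    then have "M \<in> class_C" using class_Cs_subset by blast
    show "?\<mu> < 1 / \<gamma>"
      using destabilizing[OF \<open>M \<in> class_C\<close>] inv_le stable by metis
  next
    assume M: "M \<in> class_C" and stable: "\<forall>\<Delta> \<in> class_Cs. pos_semidef (tf_at_infinity \<Delta>) \<and>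
              tf_at_infinity \<Delta> ** tf_at_infinity M = 0 \<and>
              max_eigenvalue (tf_eval \<Delta> 0) < \<gamma> \<longrightarrow> internally_stable \<Delta> M"
    show "?\<mu> \<le> 1 / \<gamma>"
      using destabilizing[OF M] inv_less stable by metis
  next
    assume M: "M \<in> class_C" and stable: "\<forall>\<Delta> \<in> class_Cs. pos_semidef (tf_at_infinity \<Delta>) \<and>
              tf_at_infinity \<Delta> ** tf_at_infinity M = 0 \<and>
              max_eigenvalue (tf_eval \<Delta> 0) \<le> \<gamma> \<longrightarrow> internally_stable \<Delta> M"
    show "?\<mu> < 1 / \<gamma>"
      using destabilizing[OF M] inv_le stable by metis
  qed (use stable_I stable_II in blast)+
qed

end
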